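(* Let $(p_n)_{n\ge 1}\subset[1,\infty[$ and $(\sigma_n)_{n\ge1}\subset\mathbb{R}_+^*$ with $\sigma_n\to\infty$. For $n\ge1$ let $h_n:\mathbb{R}^2\to\mathbb{R}$, $h_n(x,y):=p_ne^{x+\sigma_ny}$, and set $h:=\sum_{n\ge1}h_n:\mathbb{R}^2\to\overline{\mathbb{R}}$ and $f:\mathbb{R}\to\overline{\mathbb{R}}$, $f(y):=\sum_{n\ge1}p_ne^{\sigma_ny}$. Assume that $\operatorname{dom}h\neq\emptyset$. Then $h$ and $h_n$ ($n\ge1$) are convex, $h(x,y)=e^xf(y)$ for all $(x,y)\in\mathbb{R}^2$, $\operatorname{dom}h=\mathbb{R}\times\operatorname{dom}f$, and there is $\alpha\in\mathbb{R}_+$ such that $I:={}]-\infty,-\alpha[{}\subset\operatorname{dom}f\subset\operatorname{cl}I$; fix this $\alpha$ and $I$. Moreover $\operatorname{int}(\operatorname{dom}h)=\mathbb{R}\times I\subset\bigcap_{n\ge1}\operatorname{dom}h_n=\mathbb{R}^2$, and the following hold. (i) $h$ is differentiable on $\operatorname{int}(\operatorname{dom}h)$ and $$\partial h(\operatorname{int}(\operatorname{dom}h))=\nabla h(\mathbb{R}\times I)=\{(u,v)\in\mathbb{R}^2\mid u\in\mathbb{R}_+^*,\ \theta_1u<v<\theta_2u\},$$ where $\theta_1:=\min\{\sigma_n\mid n\ge1\}$ and $\theta_2:=\lim_{y\uparrow-\alpha}f'(y)/f(y)\in{}]\theta_1,\infty]$. One has $\theta_2<\infty$ if and only if $-\alpha\in\operatorname{dom}f$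 and $\gamma:=f'_-(-\alpha)=\sum_{n\ge1}p_n\sigma_ne^{-\sigma_n\alpha}<\infty$. Moreover, if $-\alpha\in\operatorname{dom}f$ and $\gamma<\infty$, then for every $x\in\mathbb{R}$ $$e^x(f(-\alpha),\gamma)=\sum_{n\ge1}\nabla h_n(x,-\alpha)\in\partial h(x,-\alpha)=\{e^xf(-\alpha)\}\times[e^x\gamma,\infty[.$$ (ii) The function $\varphi:I\to{}]\theta_1,\theta_2[$, $\varphi(y):=f'(y)/f(y)$, is bijective and increasing; $\ln f:\mathbb{R}\to\overline{\mathbb{R}}$ is convex (even strictly convex and increasing on its domain), and, with $\Sigma:=\{n\in\mathbb{N}^*\mid\sigma_n=\theta_1\}$, $$(\ln f)^*(w)=\begin{cases}\infty&\text{if }w<\theta_1,\\-\ln\sum_{n\in\Sigma}p_n&\text{if }w=\theta_1,\\ w\varphi^{-1}(w)-\ln[f(\varphi^{-1}(w))]&\text{if }\theta_1<w<\theta_2,\\-\alpha w-\ln[f(-\alpha)]&\text{if }\theta_2\le w\end{cases}$$ (the last line being relevant only if $\theta_2<\infty$). Moreover, $\operatorname{dom}h^*=\{(u,v)\in\mathbb{R}^2\mid v\ge\theta_1u\ge0\}$ and $$h^*(u,v)=\begin{cases}u\ln u-u+u\cdot(\ln f)^*(v/u)&\text{if }v\ge\theta_1u>0,\\-\alpha v&\text{if }u=0\le v.\end{cases}$$ (iii) Let $(u,v)\in\operatorname{dom}h^*$. Then $$h^*(u,v)=\min\Big\{\sum_{n\ge1}u_n\Big(\ln\frac{u_n}{p_n}-1\Big)\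 \Big|\ (u_n)_{n\ge1}\in S(u,v)\Big\}=H(u,v)$$ (in the sense that the minimum is attained and equals both) if and only if $$(u,v)\in A:=\{(0,0)\}\cup\{(u,v)\in\mathbb{R}_+^*\times\mathbb{R}_+^*\mid\theta_1u\le v\le\theta_2u\}.$$ More precisely, for $(u,v)\in A$ the minimum is attained at a unique sequence $(\overline{u}_n)_{n\ge1}\in S(u,v)$, as follows: (a) $\overline{u}_n=0$ for all $n\geq 1$ if $(u,v)=(0,0)$; (b) $\overline{u}_n=p_nu/\sum_{k\in\Sigma}p_k$ if $n\in\Sigma$ and $\overline{u}_n=0$ if $n\in\mathbb{N}^*\setminus\Sigma$, provided $u\in\mathbb{R}_+^*$ and $v=\theta_1u$; (c) $\overline{u}_n=p_ne^{x+\sigma_ny}$ ($n\ge1$) if $u\in\mathbb{R}_+^*$ and $\theta_1u<v<\theta_2u$, where $y:=\varphi^{-1}(v/u)$ and $x:=\ln[u/f(y)]$; (d) $\overline{u}_n=p_ne^{x-\sigma_n\alpha}$ ($n\ge1$) if $\theta_2<\infty$, $u\in\mathbb{R}_+^*$ and $v=\theta_2u$, where $x:=\ln[u/f(-\alpha)]$. Moreover, $S(0,v)=\emptyset$ if $v\in\mathbb{R}_+^*$, and $h^*(u,v)=H(u,v)$ whenever $0<\theta_2u<v$ (in case $\theta_2<\infty$).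
   Context: Notation: $\mathbb{R}_+=[0,\infty[$, $\mathbb{R}_+^*={}]0,\infty[$, $\mathbb{N}^*=\{1,2,\dots\}$, $\overline{\mathbb{R}}=[-\infty,\infty]$, $0\ln0:=0$, $\ln\infty:=\infty$, $\inf\emptyset:=\infty$. For a function $g$ with values in $\overline{\mathbb{R}}$, $\operatorname{dom}g=\{g<\infty\}$; $g^*$ is the convex (Fenchel) conjugate, $g^*(w)=\sup_z(\langle z,w\rangle-g(z))$; $\partial g$ is the convex subdifferential, and $\partial g(D)=\bigcup_{z\in D}\partial g(z)$. $f'_-$ is the left derivative. Series convention: $\sum_{n\ge1}\beta_n:=\lim_{n\to\infty}\sum_{k=1}^n\beta_k$ when this limit exists in $\overline{\mathbb{R}}$ and $\sum_{n\ge1}\beta_n:=\infty$ otherwise. For $(u,v)\in\mathbb{R}^2$, $S(u,v):=\{(u_n)_{n\ge1}\subset\mathbb{R}_+\mid u=\sum_{n\ge1}u_n,\ v=\sum_{n\ge1}\sigma_nu_n\}$, and $H:\mathbb{R}^2\to\overline{\mathbb{R}}$ is the value function of the Maxwell--Boltzmann entropy minimization problem, $H(u,v):=\inf\{\sum_{n\ge1}p_nE_{MB}(u_n/p_n)\mid(u_n)_{n\ge1}\in S(u,v)\}$, where $E_{MB}(t)=t(\ln t-1)$ for $t\ge0$ and $E_{MB}(t)=\infty$ for $t<0$; thus $p_nE_{MB}(u_n/p_n)=u_n(\ln\frac{u_n}{p_n}-1)$ for $u_n\ge0$. *)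

theory Defs
  imports "HOL-Analysis.Analysis"
begin

definition edom :: "('a \<Rightarrow> ereal) \<Rightarrow> 'a set" where
  "edom g = {z. g z < \<infinity>}"

text \<open>Convexity of an extended-real-valued function is convexity of its epigraph; this
  avoids any convention about \<open>\<infinity> - \<infinity>\<close>.\<close>

definition econvex :: "('a::real_vector \<Rightarrow> ereal) \<Rightarrow> bool" where
  "econvex g \<longleftrightarrow> convex {(z, t::real). g z \<le> ereal t}"

definition strictly_econvex_on :: "'a::real_vector set \<Rightarrow> ('a \<Rightarrow> ereal) \<Rightarrow> bool" where
  "strictly_econvex_on D g \<longleftrightarrow>
     (\<forall>a\<in>D. \<forall>b\<in>D. \<forall>t\<in>{0<..<1}. a \<noteq> b \<longrightarrow>
        g ((1 - t) *\<^sub>R a + t *\<^sub>R b) < ereal (1 - t) * g a + ereal t * g b)"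

definition conjugate :: "('a::real_inner \<Rightarrow> ereal) \<Rightarrow> 'a \<Rightarrow> ereal" where
  "conjugate g w = (SUP z. ereal (z \<bullet> w) - g z)"

definition subdifferential :: "('a::real_inner \<Rightarrow> ereal) \<Rightarrow> 'a \<Rightarrow> 'a set" where
  "subdifferential g z =
     {w. \<bar>g z\<bar> \<noteq> \<infinity> \<and> (\<forall>z'. g z + ereal ((z' - z) \<bullet> w) \<le> g z')}"

definition gradient :: "('a::real_inner \<Rightarrow> real) \<Rightarrow> 'a \<Rightarrow> 'a" where
  "gradient g z = (THE D. GDERIV g z :> D)"

definition left_deriv :: "(real \<Rightarrow> ereal) \<Rightarrow> real \<Rightarrow> ereal" where
  "left_deriv g y = Lim (at_left y) (\<lambda>t. (g t - g y) / ereal (t - y))"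

fun eln :: "ereal \<Rightarrow> ereal" where
  "eln (ereal t) = (if 0 < t then ereal (ln t) else - \<infinity>)"
| "eln PInfty = \<infinity>"
| "eln MInfty = - \<infinity>"

text \<open>Sequences \<open>(\<beta>\<^sub>n)\<^sub>n\<^sub>\<ge>\<^sub>1\<close> are functions on \<open>nat\<close> whose value at \<open>0\<close> is never used.
  A series without a limit in the extended reals has the value \<open>\<infinity>\<close>.\<close>

definition eseries :: "(nat \<Rightarrow> ereal) \<Rightarrow> ereal" where
  "eseries \<beta> =
     (if convergent (\<lambda>n. \<Sum>k=1..n. \<beta> k) then lim (\<lambda>n. \<Sum>k=1..n. \<beta> k) else \<infinity>)"

definition h_term :: "(nat \<Rightarrow> real) \<Rightarrow> (nat \<Rightarrow> real) \<Rightarrow> nat \<Rightarrow> real \<times> real \<Rightarrow> real" where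
  "h_term p \<sigma> n = (\<lambda>(x, y). p n * exp (x + \<sigma> n * y))"

definition h_series :: "(nat \<Rightarrow> real) \<Rightarrow> (nat \<Rightarrow> real) \<Rightarrow> real \<times> real \<Rightarrow> ereal" where
  "h_series p \<sigma> z = eseries (\<lambda>n. ereal (h_term p \<sigma> n z))"

definition f_series :: "(nat \<Rightarrow> real) \<Rightarrow> (nat \<Rightarrow> real) \<Rightarrow> real \<Rightarrow> ereal" where
  "f_series p \<sigma> y = eseries (\<lambda>n. ereal (p n * exp (\<sigma> n * y)))"

text \<open>The convention \<open>0 ln 0 = 0\<close> holds because \<open>0 * (ln 0 - 1) = 0\<close>.\<close>

definition E_MB :: "real \<Rightarrow> ereal" where
  "E_MB t = (if t < 0 then \<infinity> else ereal (t * (ln t - 1)))"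

definition S :: "(nat \<Rightarrow> real) \<Rightarrow> real \<Rightarrow> real \<Rightarrow> (nat \<Rightarrow> real) set" where
  "S \<sigma> u v = {w. (\<forall>n\<ge>1. 0 \<le> w n) \<and>
     ereal u = eseries (\<lambda>n. ereal (w n)) \<and> ereal v = eseries (\<lambda>n. ereal (\<sigma> n * w n))}"

definition H :: "(nat \<Rightarrow> real) \<Rightarrow> (nat \<Rightarrow> real) \<Rightarrow> real \<Rightarrow> real \<Rightarrow> ereal" where
  "H p \<sigma> u v = (INF w\<in>S \<sigma> u v. eseries (\<lambda>n. ereal (p n) * E_MB (w n / p n)))"

definition entropy_sum :: "(nat \<Rightarrow> real) \<Rightarrow> (nat \<Rightarrow> real) \<Rightarrow> ereal" where
  "entropy_sum p w = eseries (\<lambda>n. ereal (w n * (ln (w n / p n) - 1)))"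

end

theory Submission
  imports Defs
begin

text \<open>
  Write \<open>\<phi> = f' / f\<close>. Jensen's inequality for the exponential gives
  \<open>f z \<ge> f y * exp (\<phi> y * (z - y))\<close>, strictly for \<open>z \<noteq> y\<close>, at every \<open>y\<close> where the differentiated
  series converges, including the end point of the domain. This yields the monotonicity of
  \<open>\<phi>\<close>, the strict convexity and the conjugate of \<open>ln f\<close>, and the subgradients of \<open>h\<close>. For the minimization
  problem, the entropy of a feasible sequence \<open>w\<close> is an affine dual value plus
  \<open>\<Sum>\<^sub>n w\<^sub>n (ln (w\<^sub>n / q\<^sub>n) - 1) + q\<^sub>n\<close> with \<open>q\<^sub>n = p\<^sub>n exp (x + \<sigma>\<^sub>n y)\<close>, a series of nonnegative terms that
  vanishes only for \<open>w = q\<close>: this gives weak duality, optimality, uniqueness and non-attainment at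
  once. Above \<open>\<theta>\<^sub>2\<close> the dual value is approached by the minimizers of the truncated problems.
\<close>

subsection \<open>Extended series and convexity\<close>

text \<open>The obstacle is the end point \<open>- alpha\<close>: \<open>f\<close> may be finite or
  infinite there and \<open>h\<close> has no two-sided derivative, so arguments by differentiation
  stop short of it. The tangent inequality asks only that the series and the differentiated series
  converge at the point of tangency, and so treats the end point like an interior one. It is strict
  because the exponents tend to infinity and cannot all equal their mean \<open>phi y\<close>. For
  \<open>v\<close> above \<open>\<theta>2 u\<close> no \<open>y\<close> in the domain has mean
  \<open>v / u\<close>. The excess in the second constraint can be carried by terms of very large
  index: as \<open>\<sigma>\<close> is unbounded, a tiny mass there supplies any prescribed amount.
  In the limit this mass disappears, so the dual value is an infimum that no feasible sequence
  attains. At the other edge, \<open>v = \<theta>1 u\<close>, the multiplier \<open>y\<close> would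
  have to be minus infinity. There the reference sequence is allowed to vanish off the indices with
  the smallest exponent.\<close>

lemma eseries_sums:
  assumes "(\<lambda>n. \<beta> (Suc n)) sums l"
  shows "eseries \<beta> = l"
proof -
  have "(\<lambda>n. \<Sum>k=1..n. \<beta> k) \<longlonglongrightarrow> l"
    using assms by (simp add: sums_def sum.atLeast1_atMost_eq)
  then show ?thesis
    unfolding eseries_def by (auto simp: convergent_def limI)
qed

lemma eseries_cong:
  assumes "\<And>n. n \<ge> 1 \<Longrightarrow> \<beta> n = \<beta>' n"
  shows "eseries \<beta> = eseries \<beta>'"
proof -
  have "(\<lambda>n. \<Sum>k=1..n. \<beta> k) = (\<lambda>n. \<Sum>k=1..n. \<beta>' k)"
    using assms by (intro ext sum.cong) auto
  then show ?thesis by (simp add: eseries_def)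
qed

lemma sums_infinity_ereal:
  fixes b :: "nat \<Rightarrow> real"
  assumes "\<And>n. 0 \<le> b n" "\<not> summable b"
  shows "(\<lambda>n. ereal (b n)) sums \<infinity>"
proof -
  have s: "(\<lambda>n. ereal (b n)) sums (\<Sum>n. ereal (b n))"
    using assms(1) by (intro summable_sums summable_ereal_pos) auto
  have "(\<Sum>n. ereal (b n)) \<ge> 0"
    using assms(1) by (intro suminf_0_le) auto
  moreover have "(\<Sum>n. ereal (b n)) \<noteq> ereal r" for r
    using s assms(2) sums_ereal by (metis summable_def)
  ultimately have "(\<Sum>n. ereal (b n)) = \<infinity>"
    by (cases "\<Sum>n. ereal (b n)") auto
  with s show ?thesis by simp
qed

lemma eseries_ereal_sums:
  assumes "(\<lambda>n. b (Suc n)) sums l"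
  shows "eseries (\<lambda>n. ereal (b n)) = ereal l"
  using assms by (intro eseries_sums) (simp add: sums_ereal)

lemma eseries_nonneg:
  assumes "\<And>n. 0 \<le> b (Suc n)"
  shows "eseries (\<lambda>n. ereal (b n)) =
    (if summable (\<lambda>n. b (Suc n)) then ereal (\<Sum>n. b (Suc n)) else \<infinity>)"
proof (cases "summable (\<lambda>n. b (Suc n))")
  case True
  then show ?thesis by (simp add: eseries_ereal_sums summable_sums)
next
  case False
  then show ?thesis
    using sums_infinity_ereal[of "\<lambda>n. b (Suc n)"] assms
    by (simp add: eseries_sums)
qed

lemma eseries_nonneg_eq_iff:
  assumes "\<And>n. 0 \<le> b (Suc n)"
  shows "ereal u = eseries (\<lambda>n. ereal (b n)) \<longleftrightarrow> (\<lambda>n. b (Suc n)) sums u"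
  using eseries_nonneg[of b, OF assms] by (auto simp: sums_iff)

text \<open>Entropy terms have no fixed sign. Writing them as a convergent part plus nonnegative
  terms makes the partial sums converge in the extended reals, so the default value for series
  without a limit never decides the entropy.\<close>

lemma eseries_add:
  assumes c: "(\<lambda>n. c (Suc n)) sums l" and r: "\<And>n. 0 \<le> r (Suc n)"
  shows "eseries (\<lambda>n. ereal (c n + r n)) = ereal l + eseries (\<lambda>n. ereal (r n))"
proof (cases "summable (\<lambda>n. r (Suc n))")
  case True
  then have "(\<lambda>n. c (Suc n) + r (Suc n)) sums (l + (\<Sum>n. r (Suc n)))"
    using c by (intro sums_add) (auto simp: summable_sums)
  with True eseries_nonneg[of r, OF r] show ?thesis
    by (simp add: eseries_ereal_sums)
next
  case False
  have "(\<lambda>N. ereal (\<Sum>n<N. c (Suc n)) + (\<Sum>n<N. ereal (r (Suc n)))) \<longlonglongrightarrow> ereal l + \<infinity>"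
    using c sums_infinity_ereal[of "\<lambda>n. r (Suc n)", OF r False]
    by (intro tendsto_add_ereal_general) (auto simp: sums_def)
  then have "(\<lambda>n. ereal (c (Suc n) + r (Suc n))) sums \<infinity>"
    by (simp add: sums_def sum.distrib)
  with False eseries_nonneg[of r, OF r] show ?thesis
    by (simp add: eseries_sums)
qed

lemma eseries_eq_0_iff:
  assumes "\<And>n. 0 \<le> b (Suc n)"
  shows "eseries (\<lambda>n. ereal (b n)) = 0 \<longleftrightarrow> (\<forall>n\<ge>1. b n = 0)"
proof -
  have *: "(\<forall>n. b (Suc n) = 0) \<longleftrightarrow> (\<forall>n\<ge>1. b n = 0)"
    by (metis One_nat_def Suc_le_D le_add1 plus_1_eq_Suc)
  show ?thesis
  proof (cases "summable (\<lambda>n. b (Suc n))")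
    case True
    then show ?thesis using assms * suminf_eq_zero_iff[of "\<lambda>n. b (Suc n)"]
      by (simp add: eseries_nonneg)
  next
    case False
    moreover have "\<exists>n. b (Suc n) \<noteq> 0"
    proof (rule ccontr)
      assume "\<not> ?thesis"
      then have "(\<lambda>n. b (Suc n)) = (\<lambda>n. 0)" by auto
      with False show False by simp
    qed
    ultimately show ?thesis using assms * by (auto simp: eseries_nonneg)
  qed
qed

lemma eseries_ge_0:
  assumes "\<And>n. 0 \<le> b (Suc n)"
  shows "0 \<le> eseries (\<lambda>n. ereal (b n))"
  using eseries_nonneg[of b, OF assms] assms by (simp add: suminf_nonneg)

text \<open>Used to compute conjugates: a bound \<open>r\<close> on a supremum unfolds to a real
  inequality at every point, without arithmetic on infinite values.\<close>

lemma ereal_eqI_real_upper_bounds: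
  fixes A B :: ereal
  assumes "\<And>r. A \<le> ereal r \<longleftrightarrow> B \<le> ereal r"
  shows "A = B"
  using assms by (metis dense_le_bounded ereal_le_real order_antisym)

lemma econvexI:
  fixes g :: "'a::real_vector \<Rightarrow> ereal"
  assumes "\<And>x y t r q. g x \<le> ereal r \<Longrightarrow> g y \<le> ereal q \<Longrightarrow> 0 < t \<Longrightarrow> t < 1 \<Longrightarrow>
    g ((1 - t) *\<^sub>R x + t *\<^sub>R y) \<le> ereal ((1 - t) * r + t * q)"
  shows "econvex g"
  unfolding econvex_def convex_alt
proof clarsimp
  fix x y r q t
  assume "g x \<le> ereal r" "g y \<le> ereal q" "0 \<le> t" "t \<le> (1::real)"
  then show "g ((1 - t) *\<^sub>R x + t *\<^sub>R y) \<le> ereal ((1 - t) * r + t * q)"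
    using assms[of x r y q t] by (cases "t = 0 \<or> t = 1") auto
qed

lemma exp_affine_convex:
  fixes c :: real
  assumes "0 \<le> c"
  shows "convex_on UNIV (\<lambda>(x, y). c * exp (x + k * y))"
proof (rule convex_onI)
  fix t :: real and z w :: "real \<times> real"
  assume t: "0 < t" "t < 1"
  obtain x y x' y' where zw: "z = (x, y)" "w = (x', y')" by (cases z, cases w)
  have "exp ((1 - t) *\<^sub>R (x + k * y) + t *\<^sub>R (x' + k * y'))
      \<le> (1 - t) * exp (x + k * y) + t * exp (x' + k * y')"
    using t by (intro convex_onD[OF exp_convex]) auto
  from mult_left_mono[OF this assms]
  show "(case (1 - t) *\<^sub>R z + t *\<^sub>R w of (x, y) \<Rightarrow> c * exp (x + k * y))
    \<le> (1 - t) * (case z of (x, y) \<Rightarrow> c * exp (x + k * y)) + t * (case w of (x, y) \<Rightarrow> c * exp (x + k * y))"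
    by (simp add: zw algebra_simps)
qed simp

lemma gradient_eqI:
  fixes g :: "'a::euclidean_space \<Rightarrow> real"
  assumes "GDERIV g z :> d"
  shows "gradient g z = d"
  unfolding gradient_def
proof (rule the_equality)
  fix e assume "GDERIV g z :> e"
  with assms have "(\<lambda>x. x \<bullet> d) = (\<lambda>x. x \<bullet> e)"
    unfolding gderiv_def by (rule has_derivative_unique)
  then have "x \<bullet> d = x \<bullet> e" for x by metis
  then show "e = d" by (metis vector_eq_ldot)
qed fact

lemma ereal_eq_infinityI:
  assumes "\<And>r. \<not> A \<le> ereal r"
  shows "A = \<infinity>"
  using assms by (cases A) auto

text \<open>A term of the generalized Kullback-Leibler divergence,
  \<open>w ln (w / q) - w + q\<close>. At \<open>w = 0\<close> it equals \<open>q\<close>, as the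
  factor \<open>w\<close> annihilates the logarithm.\<close>

definition gap :: "real \<Rightarrow> real \<Rightarrow> real" where
  "gap w q = w * (ln (w / q) - 1) + q"

text \<open>For \<open>w > 0\<close> this is \<open>ln t \<le> t - 1\<close> at
  \<open>t = q / w\<close>, where equality forces \<open>t = 1\<close>.\<close>

lemma gap_pos:
  assumes "0 \<le> w" "0 < q" "w \<noteq> q"
  shows "0 < gap w q"
proof (cases "w = 0")
  case False
  then have w: "0 < w" using assms by simp
  have "ln (q / w) \<noteq> q / w - 1"
    using ln_eq_minus_one[of "q / w"] w assms by auto
  then have "ln (q / w) < q / w - 1"
    using ln_le_minus_one[of "q / w"] w assms by simp
  then have "w * ln (q / w) < w * (q / w - 1)" using w by (rule mult_strict_left_mono)
  moreover have "ln (w / q) = - ln (q / w)" using w assms by (simp add: ln_div)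
  ultimately show ?thesis using w by (simp add: gap_def algebra_simps)
qed (use assms in \<open>simp add: gap_def\<close>)

lemma gap_self: "gap q q = 0"
  by (simp add: gap_def)

lemma gap_nonneg: "0 \<le> w \<Longrightarrow> 0 < q \<Longrightarrow> 0 \<le> gap w q"
  using gap_pos[of w q] gap_self by (cases "w = q") auto

text \<open>The Fenchel-Young inequality for the exponential, read off from
  \<open>gap u (exp x * b) \<ge> 0\<close>; equality holds at \<open>x = ln (u / b)\<close>.\<close>

lemma exp_conjugate_le:
  fixes x u b :: real
  assumes "0 < u" "0 < b"
  shows "x * u - exp x * b \<le> u * ln u - u - u * ln b"
  using gap_nonneg[of u "exp x * b"] assms
  by (simp add: gap_def ln_div ln_mult algebra_simps)

lemma image_from_1: "g ` {1..} = range (\<lambda>n. g (Suc n))" for g :: "nat \<Rightarrow> 'b"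
proof -
  have "range Suc = {1..}" by (simp add: Suc_le_eq greaterThan_0 atLeast_Suc_greaterThan)
  then show ?thesis by (metis image_image)
qed

subsection \<open>Exponential series\<close>

text \<open>A Dirichlet series with free weights: weights \<open>a n * s n\<close> give the
  derivative, and cut-off weights give the truncations. The value is meaningful only on
  \<open>expdom\<close>.\<close>

definition expser :: "(nat \<Rightarrow> real) \<Rightarrow> (nat \<Rightarrow> real) \<Rightarrow> real \<Rightarrow> real" where
  "expser a s y = (\<Sum>n. a n * exp (s n * y))"

definition expdom :: "(nat \<Rightarrow> real) \<Rightarrow> (nat \<Rightarrow> real) \<Rightarrow> real set" where
  "expdom a s = {y. summable (\<lambda>n. a n * exp (s n * y))}"

lemma expser_sums: "y \<in> expdom a s \<Longrightarrow> (\<lambda>n. a n * exp (s n * y)) sums expser a s y"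
  by (simp add: expser_def expdom_def summable_sums)

text \<open>Weights are only nonnegative here, so that truncated series, with weight 0 from some
  index on, are instances as well.\<close>

locale exp_series =
  fixes a s :: "nat \<Rightarrow> real"
  assumes a_nonneg: "0 \<le> a n" and s_pos: "0 < s n"
begin

lemma weighted: "exp_series (\<lambda>n. a n * s n) s"
  by unfold_locales (auto simp: a_nonneg s_pos less_imp_le)

lemma sum_le_expser: "y \<in> expdom a s \<Longrightarrow> (\<Sum>n<N. a n * exp (s n * y)) \<le> expser a s y"
  unfolding expser_def expdom_def using a_nonneg by (auto intro!: sum_le_suminf)

lemma expser_ge_term:
  assumes "y \<in> expdom a s"
  shows "a n * exp (s n * y) \<le> expser a s y"
proof -
  have "a n * exp (s n * y) \<le> (\<Sum>k<Suc n. a k * exp (s k * y))"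
    using a_nonneg by (intro member_le_sum) auto
  also note sum_le_expser[OF assms]
  finally show ?thesis .
qed

lemma expser_pos: "y \<in> expdom a s \<Longrightarrow> 0 < a n \<Longrightarrow> 0 < expser a s y"
  using expser_ge_term[of y n] by (smt (verit) exp_gt_zero mult_pos_pos)

lemma expdom_bounded_sums:
  assumes "\<And>N. (\<Sum>n<N. a n * exp (s n * y)) \<le> C"
  shows "y \<in> expdom a s"
  unfolding expdom_def using assms a_nonneg by (auto intro!: summableI_nonneg_bounded)

lemma term_mono: "y \<le> b \<Longrightarrow> a n * exp (s n * y) \<le> a n * exp (s n * b)"
  using a_nonneg s_pos[of n] by (simp add: mult_left_mono)

lemma expdom_mono:
  assumes "b \<in> expdom a s" "y \<le> b"
  shows "y \<in> expdom a s"
  using assms a_nonneg term_mono unfolding expdom_def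
  by (auto intro!: summable_comparison_test'[where g = "\<lambda>n. a n * exp (s n * b)" and N = 0])

text \<open>The extra factor \<open>s n\<close> is absorbed by \<open>exp (s n * (b - y))\<close>,
  because \<open>t \<le> exp t\<close>.\<close>

lemma expdom_weighted:
  assumes "b \<in> expdom a s" "y < b"
  shows "y \<in> expdom (\<lambda>n. a n * s n) s"
proof -
  have "a n * s n * exp (s n * y) \<le> a n * exp (s n * b) * (1 / (b - y))" for n
  proof -
    have "s n * (b - y) \<le> exp (s n * (b - y))"
      using exp_ge_add_one_self[of "s n * (b - y)"] by linarith
    then have "s n \<le> exp (s n * (b - y)) / (b - y)"
      using assms(2) by (simp add: field_simps)
    then have "s n * exp (s n * y) \<le> exp (s n * (b - y)) / (b - y) * exp (s n * y)"
      by (rule mult_right_mono) simp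
    also have "\<dots> = exp (s n * b) / (b - y)"
      by (simp add: exp_add[symmetric] algebra_simps)
    finally show ?thesis
      using a_nonneg[of n] mult_left_mono by fastforce
  qed
  moreover have "summable (\<lambda>n. a n * exp (s n * b) * (1 / (b - y)))"
    using assms(1) unfolding expdom_def by (intro summable_mult2) simp
  ultimately have "summable (\<lambda>n. a n * s n * exp (s n * y))"
    using a_nonneg s_pos
    by (rule_tac summable_comparison_test'[where N = 0 and g = "\<lambda>n. a n * exp (s n * b) * (1 / (b - y))"])
      (auto simp del: times_divide_eq_right simp: abs_mult less_imp_le)
  then show ?thesis by (simp add: expdom_def)
qed

text \<open>The terms at \<open>b\<close> dominate all terms to the left, so convergence is uniform
  up to and including \<open>b\<close>. This gives left continuity at an end point of the
  domain.\<close>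

lemma expser_continuous_on:
  assumes "b \<in> expdom a s"
  shows "continuous_on {..b} (expser a s)"
proof -
  have "uniform_limit {..b} (\<lambda>n y. \<Sum>i<n. a i * exp (s i * y)) (expser a s) sequentially"
    unfolding expser_def
    using assms a_nonneg term_mono unfolding expdom_def
    by (intro Weierstrass_m_test[where M = "\<lambda>n. a n * exp (s n * b)"]) auto
  then show ?thesis
    by (rule uniform_limit_theorem[rotated]) (auto intro!: continuous_intros always_eventually)
qed

lemma DERIV_expser:
  assumes "b \<in> expdom a s" "y < b"
  shows "(expser a s has_field_derivative expser (\<lambda>n. a n * s n) s y) (at y)"
proof -
  \<comment> \<open>Termwise differentiation needs uniform convergence of the differentiated series
    around \<open>y\<close>; \<open>c\<close> leaves room for it and still lies in the domain of
    that series.\<close>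
  obtain c where c: "y < c" "c < b" using assms(2) dense by blast
  interpret W: exp_series "\<lambda>n. a n * s n" s by (rule weighted)
  have cW: "c \<in> expdom (\<lambda>n. a n * s n) s" using assms(1) c(2) by (rule expdom_weighted)
  have "((\<lambda>y. \<Sum>n. a n * exp (s n * y)) has_field_derivative (\<Sum>n. a n * s n * exp (s n * y))) (at y)"
  proof (rule has_field_derivative_series'(2)[where S = "{..c}" and f = "\<lambda>n y. a n * exp (s n * y)"
        and f' = "\<lambda>n y. a n * s n * exp (s n * y)" and ?x0.0 = c])
    show "uniformly_convergent_on {..c} (\<lambda>n x. \<Sum>i<n. a i * s i * exp (s i * x))"
      using cW W.a_nonneg W.term_mono unfolding expdom_def
      by (intro Weierstrass_m_test'[where M = "\<lambda>n. a n * s n * exp (s n * c)"]) auto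
    show "summable (\<lambda>n. a n * exp (s n * c))"
      using expdom_mono[OF assms(1)] c by (auto simp: expdom_def)
  qed (use c in \<open>auto intro!: derivative_eq_intros\<close>)
  then show ?thesis by (simp add: expser_def[abs_def])
qed

text \<open>Jensen's inequality for the exponential, obtained by summing the tangent inequality
  \<open>exp t \<ge> 1 + t\<close> at \<open>t = (s n - w) * (z - y)\<close>, where the weights \<open>a n * exp (s n * y)\<close> have mean \<open>w\<close>.\<close>

lemma expser_tangent:
  assumes y: "y \<in> expdom a s" and y1: "y \<in> expdom (\<lambda>n. a n * s n) s" and z: "z \<in> expdom a s"
    and w: "expser (\<lambda>n. a n * s n) s y = w * expser a s y"
  shows "expser a s y * exp (w * (z - y)) \<le> expser a s z"
    and "z \<noteq> y \<Longrightarrow> 0 < a m \<Longrightarrow> s m \<noteq> w \<Longrightarrow> expser a s y * exp (w * (z - y)) < expser a s z"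
proof -
  let ?e = "exp (w * (z - y))"
  let ?g = "\<lambda>n. a n * exp (s n * z) -
     (a n * exp (s n * y) * (1 - w * (z - y)) + a n * s n * exp (s n * y) * (z - y)) * ?e"
  have eq: "?g n = a n * exp (s n * y) * ?e * (exp ((s n - w) * (z - y)) - (1 + (s n - w) * (z - y)))" for n
  proof -
    have "exp (s n * z) = exp (s n * y) * ?e * exp ((s n - w) * (z - y))"
      by (simp add: exp_add[symmetric] algebra_simps)
    then show ?thesis by (simp only:) (simp add: algebra_simps)
  qed
  have nonneg: "0 \<le> ?g n" for n
    unfolding eq using a_nonneg[of n] exp_ge_add_one_self[of "(s n - w) * (z - y)"]
    by (intro mult_nonneg_nonneg) auto
  have "?g sums (expser a s z - (expser a s y * (1 - w * (z - y))
      + expser (\<lambda>n. a n * s n) s y * (z - y)) * ?e)"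
    using expser_sums[OF y] expser_sums[OF y1] expser_sums[OF z]
    by (intro sums_diff sums_mult2 sums_add)
  also have "(expser a s y * (1 - w * (z - y)) + expser (\<lambda>n. a n * s n) s y * (z - y)) = expser a s y"
    unfolding w by (simp add: algebra_simps)
  finally have sums: "?g sums (expser a s z - expser a s y * ?e)" .
  have "0 \<le> expser a s z - expser a s y * ?e"
    using nonneg sums by (rule sums_le[OF _ sums_zero])
  then show "expser a s y * ?e \<le> expser a s z" by simp
  assume "z \<noteq> y" "0 < a m" "s m \<noteq> w"
  then have "0 < ?g m"
    unfolding eq using exp_minus_greater[of "- ((s m - w) * (z - y))"]
    by (intro mult_pos_pos) (auto )
  then have "0 < suminf ?g"
    using sums nonneg by (subst suminf_pos_iff) (auto simp: sums_iff)
  then show "expser a s y * ?e < expser a s z"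
    using sums by (simp add: sums_iff)
qed

end

subsection \<open>The function \<open>f\<close> and its logarithmic derivative\<close>

locale mb_series = exp_series +
  assumes a_ge_1: "1 \<le> a n"
    and s_lim: "filterlim s at_top sequentially"
    and dom_nonempty: "expdom a s \<noteq> {}"
begin

abbreviation D where "D \<equiv> expdom a s"
abbreviation D1 where "D1 \<equiv> expdom (\<lambda>n. a n * s n) s"
abbreviation F where "F \<equiv> expser a s"
abbreviation F1 where "F1 \<equiv> expser (\<lambda>n. a n * s n) s"

definition phi :: "real \<Rightarrow> real" where "phi y = F1 y / F y"
definition alpha :: real where "alpha = - Sup D"
definition t1 :: real where "t1 = (LEAST x. x \<in> range s)"
text \<open>The set \<open>\<Sigma>\<close> of the statement, with indices starting at 0;
  \<open>P\<close> is its total weight.\<close>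

definition M :: "nat set" where "M = {n. s n = t1}"
definition P :: real where "P = (\<Sum>n\<in>M. a n)"
text \<open>A supremum is easier to handle than the limit in the statement; monotonicity of
  \<open>phi\<close> identifies the two in \<open>phi_tendsto_t2\<close>.\<close>

definition t2 :: ereal where "t2 = (SUP y\<in>{..<- alpha}. ereal (phi y))"

sublocale W: exp_series "\<lambda>n. a n * s n" s
  by (rule weighted)

lemma a_pos: "0 < a n"
  using a_ge_1[of n] by linarith

text \<open>For \<open>y \<ge> 0\<close> every term is at least 1 because
  \<open>a n \<ge> 1\<close>, so the terms do not tend to 0. This makes \<open>alpha\<close> well
  defined and nonnegative.\<close>

lemma dom_neg:
  assumes "y \<in> D"
  shows "y < 0"
proof (rule ccontr)
  assume "\<not> y < 0"
  then have "1 \<le> a n * exp (s n * y)" for n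
    using a_ge_1[of n] s_pos[of n] mult_mono[of 1 "a n" 1 "exp (s n * y)"] by simp
  moreover have "(\<lambda>n. a n * exp (s n * y)) \<longlonglongrightarrow> 0"
    using assms by (auto simp: expdom_def intro: summable_LIMSEQ_zero)
  ultimately have "(1::real) \<le> 0"
    by (intro LIMSEQ_le_const) auto
  then show False by simp
qed

lemma dom_bdd: "bdd_above D"
  using dom_neg by (intro bdd_aboveI[of _ 0]) (auto intro: less_imp_le)

lemma dom_le: "y \<in> D \<Longrightarrow> y \<le> - alpha"
  using dom_bdd by (simp add: alpha_def cSup_upper)

lemma in_dom: "y < - alpha \<Longrightarrow> y \<in> D"
  using less_cSup_iff[OF dom_nonempty dom_bdd, of y] expdom_mono
  by (auto simp: alpha_def)

lemma alpha_nonneg: "0 \<le> alpha"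
  using dom_nonempty dom_neg cSup_least[of D 0] by (force simp: alpha_def)

lemma in_dom1: "y < - alpha \<Longrightarrow> y \<in> D1"
  using dense[of y "- alpha"] in_dom expdom_weighted by blast

section \<open>The smallest exponent and the gap above it\<close>

lemma finite_s_le: "finite {n. s n \<le> c}"
proof -
  have "eventually (\<lambda>n. c < s n) sequentially"
    using s_lim by (simp add: filterlim_at_top_dense)
  then obtain N where "\<And>n. n \<ge> N \<Longrightarrow> c < s n"
    by (auto simp: eventually_sequentially)
  then have "{n. s n \<le> c} \<subseteq> {..<N}" by (force simp: not_less[symmetric])
  then show ?thesis by (rule finite_subset) simp
qed

lemma t1_in: "t1 \<in> range s" and t1_le: "t1 \<le> s n"
proof -
  let ?m = "Min (s ` {n. s n \<le> s 0})"
  have m: "?m \<in> s ` {n. s n \<le> s 0}"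
    using finite_s_le by (intro Min_in) auto
  have le: "?m \<le> s n" for n
  proof (cases "s n \<le> s 0")
    case True
    then show ?thesis using finite_s_le by (intro Min_le) auto
  next
    case False
    moreover have "?m \<le> s 0" using m by auto
    ultimately show ?thesis by linarith
  qed
  have "t1 = ?m"
    unfolding t1_def using m le by (intro Least_equality) auto
  with m le show "t1 \<in> range s" "t1 \<le> s n" by auto
qed

lemma t1_pos: "0 < t1"
  using t1_in s_pos by auto

lemma finite_M: "finite M"
  by (rule finite_subset[OF _ finite_s_le[of t1]]) (auto simp: M_def)

lemma M_nonempty: "M \<noteq> {}"
  using t1_in by (auto simp: M_def)

lemma P_pos: "0 < P"
  unfolding P_def using finite_M M_nonempty a_pos by (intro sum_pos) auto

text \<open>Only finitely many exponents are at most \<open>t1 + 1\<close>, so those above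
  \<open>t1\<close> keep a positive distance from it. The 1 inserted into the minimum covers all
  larger exponents.\<close>

lemma s_gap:
  obtains d where "0 < d" "\<And>n. n \<notin> M \<Longrightarrow> t1 + d \<le> s n"
proof -
  let ?B = "{n. s n \<le> t1 + 1} - M"
  let ?d = "Min (insert 1 ((\<lambda>n. s n - t1) ` ?B))"
  have fin: "finite (insert 1 ((\<lambda>n. s n - t1) ` ?B))"
    using finite_s_le by auto
  have "0 < ?d"
    using fin t1_le by (subst Min_gr_iff) (auto simp: M_def less_le)
  moreover have "t1 + ?d \<le> s n" if "n \<notin> M" for n
  proof (cases "s n \<le> t1 + 1")
    case True
    then have "?d \<le> s n - t1"
      using fin that by (intro Min_le) auto
    then show ?thesis by linarith
  next
    case False
    moreover have "?d \<le> 1" using fin by (intro Min_le) auto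
    ultimately show ?thesis by linarith
  qed
  ultimately show ?thesis using that by blast
qed

lemma s_unbounded: "\<exists>n. c < s n"
  using finite_s_le[of c] infinite_UNIV_nat
  by (metis (mono_tags, lifting) UNIV_eq_I linorder_not_le mem_Collect_eq)

lemma F_pos: "y \<in> D \<Longrightarrow> 0 < F y"
  using expser_pos a_pos by blast

lemma F1_eq: "y \<in> D \<Longrightarrow> F1 y = phi y * F y"
  using F_pos[of y] by (simp add: phi_def)

text \<open>Strictness needs one exponent different from the mean \<open>phi y\<close>;
  unboundedness of \<open>s\<close> supplies one above it.\<close>

lemma tangent:
  assumes "y \<in> D" "y \<in> D1" "z \<in> D"
  shows "F y * exp (phi y * (z - y)) \<le> F z"
    and "z \<noteq> y \<Longrightarrow> F y * exp (phi y * (z - y)) < F z"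
  using expser_tangent[OF assms F1_eq[OF assms(1)]] a_pos s_unbounded[of "phi y"]
  by (blast, metis less_irrefl)

lemma ln_tangent:
  assumes "y \<in> D" "y \<in> D1" "z \<in> D"
  shows "ln (F y) + phi y * (z - y) \<le> ln (F z)"
    and "z \<noteq> y \<Longrightarrow> ln (F y) + phi y * (z - y) < ln (F z)"
proof -
  have eq: "ln (F y * exp (phi y * (z - y))) = ln (F y) + phi y * (z - y)"
    using F_pos[OF assms(1)] by (simp add: ln_mult)
  show "ln (F y) + phi y * (z - y) \<le> ln (F z)"
    using tangent(1)[OF assms] F_pos assms unfolding eq[symmetric] by (subst ln_le_cancel_iff) auto
  show "ln (F y) + phi y * (z - y) < ln (F z)" if "z \<noteq> y"
    using tangent(2)[OF assms that] F_pos assms unfolding eq[symmetric] by (subst ln_less_cancel_iff) auto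
qed

text \<open>Adding the strict tangent inequalities at \<open>y\<close> and at \<open>z\<close>
  leaves \<open>(phi z - phi y) * (z - y) > 0\<close>.\<close>

lemma phi_strict_mono:
  assumes "y \<in> D" "y \<in> D1" "z \<in> D" "z \<in> D1" "y < z"
  shows "phi y < phi z"
proof -
  have "ln (F y) + phi y * (z - y) < ln (F z)" "ln (F z) + phi z * (y - z) < ln (F y)"
    using assms ln_tangent(2) by auto
  then have "phi y * (z - y) < phi z * (z - y)" by (simp add: algebra_simps)
  with assms(5) show ?thesis by simp
qed

text \<open>\<open>phi y\<close> is a weighted mean of exponents that are all at least
  \<open>t1\<close>, with some exponent strictly larger.\<close>

lemma t1_less_phi:
  assumes "y \<in> D" "y \<in> D1"
  shows "t1 < phi y"
proof -
  let ?g = "\<lambda>n. a n * s n * exp (s n * y) - t1 * (a n * exp (s n * y))"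
  have g: "?g n = a n * (s n - t1) * exp (s n * y)" for n by (simp add: algebra_simps)
  have sums: "?g sums (F1 y - t1 * F y)"
    using expser_sums[OF assms(1)] expser_sums[OF assms(2)] by (intro sums_diff sums_mult)
  obtain m where "t1 < s m" using s_unbounded by blast
  then have "0 < ?g m" unfolding g using a_pos by simp
  moreover have "0 \<le> ?g n" for n unfolding g using a_nonneg t1_le by simp
  ultimately have "0 < suminf ?g"
    using sums by (subst suminf_pos_iff) (auto simp: sums_iff)
  then have "t1 * F y < F1 y" using sums by (simp add: sums_iff)
  then show ?thesis using F_pos[OF assms(1)] by (simp add: phi_def pos_less_divide_eq)
qed

lemma phi_continuous_on:
  assumes "b \<in> D" "b \<in> D1"
  shows "continuous_on {..b} phi"
  unfolding phi_def[abs_def]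
  using assms expser_continuous_on W.expser_continuous_on expdom_mono F_pos
  by (intro continuous_on_divide) (auto simp: less_imp_neq[symmetric])

section \<open>Behaviour of \<open>F\<close> and \<open>phi\<close> at minus infinity\<close>

lemma F_lower:
  assumes "z \<in> D"
  shows "P * exp (t1 * z) \<le> F z"
proof -
  have "P * exp (t1 * z) = (\<Sum>n\<in>M. a n * exp (s n * z))"
    unfolding P_def sum_distrib_right by (rule sum.cong) (auto simp: M_def)
  also have "\<dots> \<le> F z"
    unfolding expser_def using assms a_nonneg finite_M
    by (intro sum_le_suminf) (auto simp: expdom_def)
  finally show ?thesis .
qed

text \<open>Moving left from \<open>b\<close>, every term decays at least at the rate
  \<open>t1\<close>.\<close>

lemma F_upper:
  assumes "b \<in> D" "z \<le> b"
  shows "F z \<le> exp (t1 * (z - b)) * F b"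
proof -
  have "a n * exp (s n * z) \<le> exp (t1 * (z - b)) * (a n * exp (s n * b))" for n
  proof -
    have "s n * (z - b) \<le> t1 * (z - b)"
      using t1_le[of n] assms(2) by (intro mult_right_mono_neg) auto
    then have "exp (s n * z) \<le> exp (t1 * (z - b)) * exp (s n * b)"
      unfolding exp_add[symmetric] by (simp add: algebra_simps)
    from mult_left_mono[OF this a_nonneg[of n]] show ?thesis by (simp add: mult_ac)
  qed
  moreover note expser_sums[OF expdom_mono[OF assms]] sums_mult[OF expser_sums[OF assms(1)]]
  ultimately show ?thesis by (rule sums_le)
qed

text \<open>The counterpart of \<open>F_lower\<close>: far to the left \<open>F z\<close> behaves
  like \<open>P * exp (t1 * z)\<close>, because terms outside \<open>M\<close> decay faster by a
  factor \<open>exp (d * z)\<close>.\<close>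

lemma F_upper_near:
  assumes "0 < e"
  obtains z where "z < - alpha" "F z \<le> (P + e) * exp (t1 * z)"
proof -
  obtain d where d: "0 < d" "\<And>n. n \<notin> M \<Longrightarrow> t1 + d \<le> s n" using s_gap by metis
  define b where "b = - alpha - 1"
  have b: "b \<in> D" "b < - alpha" using in_dom by (auto simp: b_def)
  \<comment> \<open>Chosen so that
    \<open>exp ((t1 + d) * (z - b)) * F b = C * exp ((t1 + d) * z)\<close>. Indices in
    \<open>M\<close> are counted in this remainder too, which only enlarges the bound.\<close>
  define C where "C = F b * exp (- (t1 + d) * b)"
  have bound: "F z \<le> P * exp (t1 * z) + C * exp ((t1 + d) * z)" if "z \<le> b" for z
  proof -
    have "(\<lambda>n. if n \<in> M then a n * exp (t1 * z) else 0) sums (\<Sum>n\<in>M. a n * exp (t1 * z))"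
      using finite_M by (rule sums_If_finite_set)
    moreover have "(\<lambda>n. exp ((t1 + d) * (z - b)) * (a n * exp (s n * b))) sums (exp ((t1 + d) * (z - b)) * F b)"
      using expser_sums[OF b(1)] by (rule sums_mult)
    ultimately have sums: "(\<lambda>n. (if n \<in> M then a n * exp (t1 * z) else 0)
        + exp ((t1 + d) * (z - b)) * (a n * exp (s n * b)))
      sums ((\<Sum>n\<in>M. a n * exp (t1 * z)) + exp ((t1 + d) * (z - b)) * F b)"
      by (rule sums_add)
    have term_le: "a n * exp (s n * z) \<le> (if n \<in> M then a n * exp (t1 * z) else 0)
        + exp ((t1 + d) * (z - b)) * (a n * exp (s n * b))" for n
    proof (cases "n \<in> M")
      case True
      then show ?thesis using a_nonneg[of n] by (simp add: M_def)
    next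
      case False
      then have "s n * (z - b) \<le> (t1 + d) * (z - b)"
        using d(2)[of n] that by (intro mult_right_mono_neg) auto
      then have "exp (s n * z) \<le> exp ((t1 + d) * (z - b)) * exp (s n * b)"
        unfolding exp_add[symmetric] by (simp add: algebra_simps)
      from mult_left_mono[OF this a_nonneg[of n]] False show ?thesis by (simp add: mult_ac)
    qed
    have "F z \<le> (\<Sum>n\<in>M. a n * exp (t1 * z)) + exp ((t1 + d) * (z - b)) * F b"
      using term_le expser_sums[OF expdom_mono[OF b(1) that]] sums by (rule sums_le)
    also have "\<dots> = P * exp (t1 * z) + C * exp ((t1 + d) * z)"
      by (simp add: P_def C_def sum_distrib_right exp_add[symmetric] algebra_simps)
    finally show ?thesis .
  qed
  have "((\<lambda>z. C * exp (d * z)) \<longlongrightarrow> C * 0) at_bot"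
    using d(1) by (intro tendsto_mult tendsto_const filterlim_compose[OF exp_at_bot])
      (auto intro!: filterlim_tendsto_pos_mult_at_bot[OF tendsto_const] filterlim_ident)
  then have "eventually (\<lambda>z. C * exp (d * z) < e) at_bot"
    using assms by (auto dest: order_tendstoD)
  moreover have "eventually (\<lambda>z. z \<le> b) at_bot" by (rule eventually_le_at_bot)
  ultimately have "eventually (\<lambda>z. C * exp (d * z) < e \<and> z \<le> b) at_bot" by (rule eventually_conj)
  then obtain z where z: "C * exp (d * z) < e" "z \<le> b"
    by (auto simp: eventually_at_bot_linorder)
  have "F z \<le> (P + C * exp (d * z)) * exp (t1 * z)"
    using bound[OF z(2)] by (simp add: algebra_simps exp_add)
  also have "\<dots> \<le> (P + e) * exp (t1 * z)"
    using z(1) by (intro mult_right_mono) auto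
  finally show ?thesis using that[of z] z(2) b by auto
qed

text \<open>If \<open>phi\<close> stayed above \<open>w > t1\<close> to the left of
  \<open>z\<close>, then \<open>F\<close> would decay at least like \<open>exp (w * y)\<close>
  there. This contradicts the lower bound \<open>P * exp (t1 * y)\<close> as \<open>y\<close> tends
  to minus infinity.\<close>

lemma phi_less:
  assumes "t1 < w"
  obtains y where "y < - alpha" "phi y < w"
proof -
  define z where "z = - alpha - 1"
  have z: "z \<in> D" "z < - alpha" using in_dom by (auto simp: z_def)
  have "\<exists>y<z. phi y < w"
  proof (rule ccontr)
    assume "\<not> ?thesis"
    then have ge: "w \<le> phi y" if "y < z" for y using that by force
    have "P \<le> F z * exp (- w * z) * exp ((w - t1) * y)" if y: "y < z" for y
    proof -
      have yD: "y \<in> D" "y \<in> D1" using y z in_dom in_dom1 by auto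
      have "P * exp (t1 * y) * exp (w * (z - y)) \<le> F y * exp (phi y * (z - y))"
        using F_lower[OF yD(1)] ge[OF y] y F_pos[OF yD(1)]
        by (intro mult_mono) (auto intro!: mult_right_mono)
      also have "\<dots> \<le> F z" using tangent(1)[OF yD z(1)] .
      finally have "P * exp (t1 * y + w * (z - y)) \<le> F z" by (simp add: exp_add mult.assoc)
      then have "P * exp (t1 * y + w * (z - y)) * exp (- (t1 * y) - w * (z - y))
        \<le> F z * exp (- (t1 * y) - w * (z - y))"
        by (rule mult_right_mono) simp
      moreover have "exp (t1 * y + w * (z - y)) * exp (- (t1 * y) - w * (z - y)) = 1"
        unfolding exp_add[symmetric] by simp
      ultimately have "P \<le> F z * exp (- (t1 * y) - w * (z - y))" by (simp only: mult.assoc mult_1_right)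
      also have "\<dots> = F z * exp (- w * z) * exp ((w - t1) * y)"
        by (simp add: mult.assoc exp_add[symmetric] algebra_simps)
      finally show ?thesis .
    qed
    moreover have "((\<lambda>y. F z * exp (- w * z) * exp ((w - t1) * y)) \<longlongrightarrow> F z * exp (- w * z) * 0) at_bot"
      using assms by (intro tendsto_mult tendsto_const filterlim_compose[OF exp_at_bot])
        (auto intro!: filterlim_tendsto_pos_mult_at_bot[OF tendsto_const] filterlim_ident)
    then have "((\<lambda>y. F z * exp (- w * z) * exp ((w - t1) * y)) \<longlongrightarrow> 0) at_bot" by simp
    ultimately have "P \<le> 0"
      by (intro tendsto_lowerbound[where F = at_bot]) (auto intro: eventually_mono[OF eventually_gt_at_bot[of z]])
    with P_pos show False by simp
  qed
  with z(2) that show ?thesis by (meson less_trans)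
qed

section \<open>Range of \<open>phi\<close> and behaviour at the end point\<close>

lemma phi_less_t2:
  assumes "y < - alpha"
  shows "ereal (phi y) < t2"
proof -
  obtain z where z: "y < z" "z < - alpha" using dense assms by blast
  have "phi y < phi z"
    using assms z in_dom in_dom1 by (intro phi_strict_mono) auto
  then have "ereal (phi y) < ereal (phi z)" by simp
  also have "\<dots> \<le> t2" unfolding t2_def using z by (intro SUP_upper) auto
  finally show ?thesis .
qed

lemma phi_tendsto_t2: "((\<lambda>y. ereal (phi y)) \<longlongrightarrow> t2) (at_left (- alpha))"
proof (rule order_tendstoI)
  fix c assume "c < t2"
  then obtain b where b: "b < - alpha" "c < ereal (phi b)"
    unfolding t2_def less_SUP_iff by auto
  have "eventually (\<lambda>y. y \<in> {b<..<- alpha}) (at_left (- alpha))"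
    by (rule eventually_at_leftI[OF _ b(1)])
  then show "eventually (\<lambda>y. c < ereal (phi y)) (at_left (- alpha))"
  proof eventually_elim
    case (elim y)
    then have "phi b < phi y"
      using in_dom in_dom1 by (intro phi_strict_mono) auto
    with b(2) show ?case by (meson ereal_less_eq(3) less_imp_le less_le_trans)
  qed
next
  fix c assume c: "t2 < c"
  have "eventually (\<lambda>y. y \<in> {..<- alpha}) (at_left (- alpha))"
    by (rule eventually_at_leftI[of "- alpha - 1"]) auto
  then show "eventually (\<lambda>y. ereal (phi y) < c) (at_left (- alpha))"
    by eventually_elim (use c phi_less_t2 in \<open>auto intro: less_trans\<close>)
qed

lemma t1_less_t2: "ereal t1 < t2"
proof -
  have "ereal t1 < ereal (phi (- alpha - 1))"
    using t1_less_phi[of "- alpha - 1"] in_dom in_dom1 by simp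
  also have "\<dots> < t2" by (rule phi_less_t2) simp
  finally show ?thesis .
qed

lemma phi_surj:
  assumes "t1 < w" "ereal w < t2"
  obtains y where "y < - alpha" "phi y = w"
proof -
  obtain y1 where y1: "y1 < - alpha" "phi y1 < w" using phi_less assms(1) by blast
  obtain y2 where y2: "y2 < - alpha" "w < phi y2"
    using assms(2) unfolding t2_def less_SUP_iff by auto
  have "y1 \<le> y2"
  proof (rule ccontr)
    assume "\<not> ?thesis"
    then have "phi y2 < phi y1"
      using y1 y2 in_dom in_dom1 by (intro phi_strict_mono) auto
    with y1 y2 show False by linarith
  qed
  moreover have "continuous_on {y1..y2} phi"
    using phi_continuous_on[of y2] in_dom in_dom1 y2 by (auto intro: continuous_on_subset)
  ultimately obtain y where "y1 \<le> y" "y \<le> y2" "phi y = w"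
    using IVT'[of phi y1 w y2] y1 y2 by auto
  with that[of y] y2 show ?thesis by auto
qed

lemma phi_bij: "bij_betw phi {..<- alpha} {w. t1 < w \<and> ereal w < t2}"
  unfolding bij_betw_def
proof
  show "inj_on phi {..<- alpha}"
    using in_dom in_dom1 phi_strict_mono by (intro linorder_inj_onI) (auto simp: less_imp_neq)
  show "phi ` {..<- alpha} = {w. t1 < w \<and> ereal w < t2}"
    using t1_less_phi phi_less_t2 in_dom in_dom1 by (auto elim!: phi_surj)
qed

lemma at_left_phi:
  assumes "- alpha \<in> D" "- alpha \<in> D1"
  shows "t2 = ereal (phi (- alpha))"
proof -
  have "(phi \<longlongrightarrow> phi (- alpha)) (at_left (- alpha))"
    using phi_continuous_on[OF assms] by (auto simp: continuous_on_def intro: tendsto_within_subset)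
  then have "((\<lambda>y. ereal (phi y)) \<longlongrightarrow> ereal (phi (- alpha))) (at_left (- alpha))"
    by simp
  with phi_tendsto_t2 show ?thesis
    by (intro tendsto_unique[OF trivial_limit_at_left_real])
qed

text \<open>A bound on the series to the left of \<open>- alpha\<close> bounds every partial sum
  there; partial sums are continuous, so the bound survives at \<open>- alpha\<close>, and the terms
  are nonnegative.\<close>

lemma expdom_boundary:
  assumes "exp_series b s" "\<And>y. y < - alpha \<Longrightarrow> y \<in> expdom b s"
    and "\<And>y. y < - alpha \<Longrightarrow> y0 < y \<Longrightarrow> expser b s y \<le> C" "y0 < - alpha"
  shows "- alpha \<in> expdom b s"
proof -
  interpret B: exp_series b s by fact
  have "(\<Sum>n<N. b n * exp (s n * - alpha)) \<le> C" for N
  proof (rule tendsto_upperbound)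
    show "((\<lambda>y. \<Sum>n<N. b n * exp (s n * y)) \<longlongrightarrow> (\<Sum>n<N. b n * exp (s n * - alpha))) (at_left (- alpha))"
      by (intro tendsto_intros)
    have "eventually (\<lambda>y. y \<in> {y0<..<- alpha}) (at_left (- alpha))"
      by (rule eventually_at_leftI[OF _ assms(4)])
    then show "eventually (\<lambda>y. (\<Sum>n<N. b n * exp (s n * y)) \<le> C) (at_left (- alpha))"
      by eventually_elim (use B.sum_le_expser assms(2,3) in \<open>force intro: order_trans\<close>)
  qed simp
  then show ?thesis by (rule B.expdom_bounded_sums)
qed

lemma t2_finite_iff: "t2 < \<infinity> \<longleftrightarrow> - alpha \<in> D \<and> - alpha \<in> D1"
proof
  assume "- alpha \<in> D \<and> - alpha \<in> D1"
  then show "t2 < \<infinity>" using at_left_phi by simp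
next
  assume "t2 < \<infinity>"
  then obtain T where T: "t2 = ereal T" using t1_less_t2 by (cases t2) auto
  have phi_T: "phi y < T" if "y < - alpha" for y
    using phi_less_t2[OF that] by (simp add: T)
  have T0: "0 < T" using t1_less_t2 t1_pos by (simp add: T)
  define y0 where "y0 = - alpha - 1"
  have y0: "y0 < - alpha" by (simp add: y0_def)
  \<comment> \<open>The slope of \<open>ln F\<close> is \<open>phi\<close>, which stays below
    \<open>T\<close>. Between \<open>y0\<close> and \<open>- alpha\<close> the function can
    therefore gain at most this exponential factor; \<open>y0\<close> is an arbitrary base
    point.\<close>
  define C where "C = F y0 * exp (T * (- alpha - y0))"
  have C: "F y \<le> C" if y: "y < - alpha" "y0 < y" for y
  proof -
    have "F y * exp (phi y * (y0 - y)) \<le> F y0"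
      using tangent(1) in_dom in_dom1 y y0 by blast
    then have "F y * exp (phi y * (y0 - y)) * exp (phi y * (y - y0)) \<le> F y0 * exp (phi y * (y - y0))"
      by (rule mult_right_mono) simp
    moreover have "exp (phi y * (y0 - y)) * exp (phi y * (y - y0)) = 1"
      unfolding exp_add[symmetric] by (simp add: algebra_simps)
    ultimately have "F y \<le> F y0 * exp (phi y * (y - y0))" by (simp add: mult.assoc)
    also have "\<dots> \<le> C"
      unfolding C_def using phi_T[OF y(1)] y y0 T0 F_pos[OF in_dom[OF y0]]
      by (intro mult_left_mono) (auto intro!: mult_mono)
    finally show ?thesis .
  qed
  have C1: "F1 y \<le> T * C" if y: "y < - alpha" "y0 < y" for y
    unfolding F1_eq[OF in_dom[OF y(1)]] using C[OF y] phi_T[OF y(1)] T0 F_pos[OF in_dom[OF y(1)]]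
    by (intro mult_mono) auto
  show "- alpha \<in> D \<and> - alpha \<in> D1"
    using expdom_boundary[OF exp_series_axioms in_dom C y0]
      expdom_boundary[OF weighted in_dom1 C1 y0] by blast
qed

text \<open>A monotone convergence argument: each termwise difference quotient is nonnegative by
  monotonicity and at most the derivative of its term at \<open>- alpha\<close> by convexity. Finite
  partial sums bound the limit from below, and beyond every bound if the differentiated series
  diverges.\<close>

lemma quotient_tendsto_left:
  assumes "- alpha \<in> D"
  shows "((\<lambda>t. ereal ((F t - F (- alpha)) / (t - - alpha))) \<longlongrightarrow>
    (if - alpha \<in> D1 then ereal (F1 (- alpha)) else \<infinity>)) (at_left (- alpha))"
proof -
  let ?y = "- alpha"
  let ?q = "\<lambda>t n. (a n * exp (s n * t) - a n * exp (s n * ?y)) / (t - ?y)"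
  have sums: "?q t sums ((F t - F ?y) / (t - ?y))" if "t < ?y" for t
    using expser_sums[OF in_dom[OF that]] expser_sums[OF assms] by (intro sums_divide sums_diff)
  have upper: "?q t n \<le> a n * s n * exp (s n * ?y)" if t: "t < ?y" for t n
  proof -
    have "exp (s n * ?y) * (1 + s n * (t - ?y)) \<le> exp (s n * ?y) * exp (s n * (t - ?y))"
      using exp_ge_add_one_self by (intro mult_left_mono) auto
    also have "\<dots> = exp (s n * t)" by (simp add: exp_add[symmetric] algebra_simps)
    finally have "a n * (exp (s n * ?y) * (1 + s n * (t - ?y))) \<le> a n * exp (s n * t)"
      using a_nonneg by (rule mult_left_mono)
    then have "a n * s n * exp (s n * ?y) * (t - ?y) \<le> a n * exp (s n * t) - a n * exp (s n * ?y)"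
      by (simp add: algebra_simps)
    with t show ?thesis by (simp add: neg_divide_le_eq)
  qed
  have nonneg: "0 \<le> ?q t n" if "t < ?y" for t n
    using term_mono[of t ?y n] that by (intro divide_nonpos_neg) auto
  have near: "eventually (\<lambda>t. t < ?y) (at_left ?y)"
    by (simp add: eventually_at_filter)
  have lower: "eventually (\<lambda>t. c < (F t - F ?y) / (t - ?y)) (at_left ?y)"
    if c: "c < (\<Sum>n<N. a n * s n * exp (s n * ?y))" for c N
  proof -
    have "((\<lambda>t. \<Sum>n<N. ?q t n) \<longlongrightarrow> (\<Sum>n<N. a n * s n * exp (s n * ?y))) (at_left ?y)"
    proof (intro tendsto_sum)
      fix n
      have "((\<lambda>t. a n * exp (s n * t)) has_field_derivative a n * s n * exp (s n * ?y)) (at_left ?y)"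
        by (auto intro!: derivative_eq_intros)
      then show "((\<lambda>t. ?q t n) \<longlongrightarrow> a n * s n * exp (s n * ?y)) (at_left ?y)"
        by (simp only: has_field_derivative_iff)
    qed
    then have "eventually (\<lambda>t. c < (\<Sum>n<N. ?q t n)) (at_left ?y)"
      using c by (rule order_tendstoD)
    with near show ?thesis
    proof eventually_elim
      case (elim t)
      note elim(2)
      also have "(\<Sum>n<N. ?q t n) \<le> suminf (?q t)"
        using sums nonneg elim by (intro sum_le_suminf) (auto simp: sums_iff)
      also have "\<dots> = (F t - F ?y) / (t - ?y)"
        using sums[OF elim(1)] by (simp only: sums_iff)
      finally show ?case .
    qed
  qed
  show ?thesis
  proof (cases "?y \<in> D1")
    case True
    have "((\<lambda>t. (F t - F ?y) / (t - ?y)) \<longlongrightarrow> F1 ?y) (at_left ?y)"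
    proof (rule order_tendstoI)
      fix c assume "c < F1 ?y"
      then have "eventually (\<lambda>N. c < (\<Sum>n<N. a n * s n * exp (s n * ?y))) sequentially"
        using expser_sums[OF True] unfolding sums_def by (auto dest: order_tendstoD)
      then obtain N where "c < (\<Sum>n<N. a n * s n * exp (s n * ?y))"
        by (auto simp: eventually_sequentially)
      then show "eventually (\<lambda>t. c < (F t - F ?y) / (t - ?y)) (at_left ?y)" by (rule lower)
    next
      fix c assume c: "F1 ?y < c"
      from near show "eventually (\<lambda>t. (F t - F ?y) / (t - ?y) < c) (at_left ?y)"
      proof eventually_elim
        case (elim t)
        have "(F t - F ?y) / (t - ?y) \<le> F1 ?y"
          using upper[OF elim] sums[OF elim] expser_sums[OF True] by (rule sums_le)
        with c show ?case by linarith
      qed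
    qed
    with True show ?thesis by simp
  next
    case False
    have "eventually (\<lambda>t. ereal c < ereal ((F t - F ?y) / (t - ?y))) (at_left ?y)" for c
    proof -
      have "\<exists>N. c < (\<Sum>n<N. a n * s n * exp (s n * ?y))"
        using False W.expdom_bounded_sums[of ?y c] by (meson not_le)
      then show ?thesis using lower by auto
    qed
    with False show ?thesis by (simp add: tendsto_PInfty)
  qed
qed

subsection \<open>Convexity, subgradients and conjugates\<close>

text \<open>\<open>fE\<close>, \<open>lnfE\<close> and \<open>hE\<close> stand for \<open>f\<close>,
  \<open>ln f\<close> and \<open>h\<close>; the identifications are \<open>f_series_eq\<close>,
  \<open>eln_fE\<close> and \<open>h_series_eq\<close>.\<close>

definition fE :: "real \<Rightarrow> ereal" where
  "fE y = (if y \<in> D then ereal (F y) else \<infinity>)"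

definition lnfE :: "real \<Rightarrow> ereal" where
  "lnfE y = (if y \<in> D then ereal (ln (F y)) else \<infinity>)"

definition hE :: "real \<times> real \<Rightarrow> ereal" where
  "hE z = ereal (exp (fst z)) * fE (snd z)"

lemma hE_simp: "hE (x, y) = (if y \<in> D then ereal (exp x * F y) else \<infinity>)"
  by (simp add: hE_def fE_def)

lemma edom_fE: "edom fE = D"
  by (auto simp: edom_def fE_def)

lemma edom_lnfE: "edom lnfE = D"
  by (auto simp: edom_def lnfE_def)

lemma edom_hE: "edom hE = UNIV \<times> D"
  by (auto simp: edom_def hE_simp split: if_splits)

lemma eln_fE: "eln (fE y) = lnfE y"
  using F_pos[of y] eln.simps(2) by (simp add: fE_def lnfE_def)

section \<open>Convexity and differentiability\<close>

lemma F_strict_mono: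
  assumes "z \<in> D" "y < z"
  shows "F y < F z"
proof -
  have "F y \<le> exp (t1 * (y - z)) * F z"
    using assms by (intro F_upper) auto
  also have "\<dots> < 1 * F z"
    using assms F_pos t1_pos by (intro mult_strict_right_mono) (auto simp: mult_pos_neg)
  finally show ?thesis by simp
qed

lemma lnfE_strict_mono: "strict_mono_on D lnfE"
  using F_strict_mono F_pos expdom_mono
  by (intro strict_mono_onI) (auto simp: lnfE_def)

lemma lnfE_strictly_convex: "strictly_econvex_on D lnfE"
  unfolding strictly_econvex_on_def
proof (intro ballI impI)
  fix x y t :: real
  assume xy: "x \<in> D" "y \<in> D" "x \<noteq> y" and t: "t \<in> {0<..<1}"
  let ?m = "(1 - t) *\<^sub>R x + t *\<^sub>R y"
  have my: "?m - y = (1 - t) * (x - y)" and mx: "?m - x = t * (y - x)"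
    by (simp_all add: algebra_simps)
  \<comment> \<open>The tangent at \<open>?m\<close> requires convergence of the differentiated
    series, which is known strictly below \<open>- alpha\<close>. An intermediate point lies below
    one of its end points, hence below \<open>- alpha\<close>.\<close>
  have "?m < x \<or> ?m < y"
  proof (cases "x < y")
    case True
    then have "(1 - t) * (x - y) < 0" using t by (intro mult_pos_neg) auto
    with my show ?thesis by linarith
  next
    case False
    then have "t * (y - x) < 0" using t xy by (intro mult_pos_neg) auto
    with mx show ?thesis by linarith
  qed
  then have m: "?m < - alpha" using dom_le xy by force
  have mD: "?m \<in> D" "?m \<in> D1" using m in_dom in_dom1 by auto
  have ne: "x \<noteq> ?m" "y \<noteq> ?m" using mx my t xy by auto
  have "ln (F ?m) = (1 - t) * (ln (F ?m) + phi ?m * (x - ?m)) + t * (ln (F ?m) + phi ?m * (y - ?m))"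
    by (simp add: algebra_simps)
  also have "\<dots> < (1 - t) * ln (F x) + t * ln (F y)"
    using ln_tangent(2)[OF mD xy(1) ne(1)] ln_tangent(2)[OF mD xy(2) ne(2)] t
    by (intro add_strict_mono mult_strict_left_mono) auto
  finally show "lnfE ?m < ereal (1 - t) * lnfE x + ereal t * lnfE y"
    using mD xy by (simp add: lnfE_def)
qed

lemma lnfE_convex: "econvex lnfE"
proof (rule econvexI)
  fix x y t r q :: real
  assume *: "lnfE x \<le> ereal r" "lnfE y \<le> ereal q" "0 < t" "t < 1"
  then have D: "x \<in> D" "y \<in> D" and le: "ln (F x) \<le> r" "ln (F y) \<le> q"
    by (auto simp: lnfE_def split: if_splits)
  have le': "(1 - t) * ln (F x) + t * ln (F y) \<le> (1 - t) * r + t * q"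
    using le * by (intro add_mono mult_left_mono) auto
  show "lnfE ((1 - t) *\<^sub>R x + t *\<^sub>R y) \<le> ereal ((1 - t) * r + t * q)"
  proof (cases "x = y")
    case True
    then have "(1 - t) *\<^sub>R x + t *\<^sub>R y = x" by (simp add: algebra_simps)
    with le' True D show ?thesis by (simp add: lnfE_def algebra_simps)
  next
    case False
    then have "lnfE ((1 - t) *\<^sub>R x + t *\<^sub>R y) < ereal (1 - t) * lnfE x + ereal t * lnfE y"
      using lnfE_strictly_convex D * by (auto simp: strictly_econvex_on_def)
    also have "\<dots> = ereal ((1 - t) * ln (F x) + t * ln (F y))"
      using D by (simp add: lnfE_def)
    also have "\<dots> \<le> ereal ((1 - t) * r + t * q)" using le' by simp
    finally show ?thesis by simp
  qed
qed

lemma hE_convex: "econvex hE"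
proof (rule econvexI)
  fix z w :: "real \<times> real" and t r q :: real
  assume *: "hE z \<le> ereal r" "hE w \<le> ereal q" and t: "0 < t" "t < 1"
  obtain x y x' y' where zw: "z = (x, y)" "w = (x', y')" by (cases z, cases w)
  have D: "y \<in> D" "y' \<in> D" and le: "exp x * F y \<le> r" "exp x' * F y' \<le> q"
    using * by (auto simp: zw hE_simp split: if_splits)
  let ?x = "(1 - t) * x + t * x'" and ?y = "(1 - t) * y + t * y'"
  have "?y \<le> max y y'"
    using t by (intro convex_bound_le) auto
  moreover have "max y y' \<in> D" using D by (simp add: max_def)
  ultimately have yD: "?y \<in> D" using expdom_mono by blast
  have "exp ?x * (a n * exp (s n * ?y)) \<le> (1 - t) * (exp x * (a n * exp (s n * y)))
      + t * (exp x' * (a n * exp (s n * y')))" for n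
    using convex_onD[OF exp_affine_convex[OF a_nonneg], of t "(x, y)" "(x', y')" n "s n"] t
    by (simp add: exp_add mult_ac)
  moreover have "(\<lambda>n. exp ?x * (a n * exp (s n * ?y))) sums (exp ?x * F ?y)"
    by (intro sums_mult expser_sums yD)
  moreover have "(\<lambda>n. (1 - t) * (exp x * (a n * exp (s n * y))) + t * (exp x' * (a n * exp (s n * y'))))
      sums ((1 - t) * (exp x * F y) + t * (exp x' * F y'))"
    by (intro sums_add sums_mult expser_sums D)
  ultimately have "exp ?x * F ?y \<le> (1 - t) * (exp x * F y) + t * (exp x' * F y')"
    by (rule sums_le)
  also have "\<dots> \<le> (1 - t) * r + t * q"
    using le t by (intro add_mono mult_left_mono) auto
  finally show "hE ((1 - t) *\<^sub>R z + t *\<^sub>R w) \<le> ereal ((1 - t) * r + t * q)"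
    using yD by (simp add: zw hE_simp)
qed

lemma interior_dom: "interior (UNIV \<times> D :: (real \<times> real) set) = UNIV \<times> {..<- alpha}"
proof -
  have "interior D = {..<- alpha}"
  proof
    show "{..<- alpha} \<subseteq> interior D"
      using in_dom by (intro interior_maximal) auto
    have "interior D \<subseteq> interior {..- alpha}"
      using dom_le by (intro interior_mono) auto
    then show "interior D \<subseteq> {..<- alpha}" by simp
  qed
  then show ?thesis by (simp add: interior_Times)
qed

lemma h_has_derivative:
  assumes "y < - alpha"
  shows "GDERIV (\<lambda>z. real_of_ereal (hE z)) (x, y) :> (exp x * F y, exp x * F1 y)"
  unfolding gderiv_def
proof (rule has_derivative_transform_within_open)
  show "open (UNIV \<times> {..<- alpha} :: (real \<times> real) set)" by (intro open_Times) auto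
  show "(x, y) \<in> UNIV \<times> {..<- alpha}" using assms by simp
  show "exp (fst z) * F (snd z) = real_of_ereal (hE z)" if "z \<in> UNIV \<times> {..<- alpha}" for z
    using that in_dom by (cases z) (auto simp: hE_simp)
  obtain b where b: "y < b" "b < - alpha" using dense assms by blast
  have "(F has_derivative (\<lambda>k. k * F1 y)) (at (snd (x, y)))"
    using DERIV_expser[OF in_dom[OF b(2)] b(1)]
    by (simp add: has_field_derivative_def mult_commute_abs)
  then have "((\<lambda>z. F (snd z)) has_derivative (\<lambda>k. snd k * F1 y)) (at (x, y))"
    by (rule has_derivative_compose[where f = snd, rotated]) (intro derivative_intros)
  then show "((\<lambda>z. exp (fst z) * F (snd z)) has_derivative (\<lambda>k. k \<bullet> (exp x * F y, exp x * F1 y))) (at (x, y))"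
    by (auto intro!: derivative_eq_intros ext simp: inner_prod_def algebra_simps)
qed

lemma f_deriv:
  assumes "y < - alpha"
  shows "((\<lambda>y. real_of_ereal (fE y)) has_field_derivative F1 y) (at y)"
proof (rule has_field_derivative_transform_within_open[where S = "{..<- alpha}"])
  obtain b where b: "y < b" "b < - alpha" using dense assms by blast
  show "(F has_field_derivative F1 y) (at y)"
    using DERIV_expser[OF in_dom[OF b(2)] b(1)] .
qed (use assms in_dom in \<open>auto simp: fE_def\<close>)

section \<open>Subgradients of \<open>h\<close>\<close>

text \<open>Two tangent inequalities in a row: \<open>1 + t \<le> exp t\<close> at
  \<open>t = (x' - x) + phi y * (y' - y)\<close>, then \<open>tangent\<close>. The end point is
  included.\<close>

lemma subgradient:
  assumes "y \<in> D" "y \<in> D1"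
  shows "(exp x * F y, exp x * F1 y) \<in> subdifferential hE (x, y)"
proof -
  have "exp x * F y + ((x' - x) * (exp x * F y) + (y' - y) * (exp x * F1 y)) \<le> exp x' * F y'"
    if y': "y' \<in> D" for x' y'
  proof -
    have "exp x * F y + ((x' - x) * (exp x * F y) + (y' - y) * (exp x * F1 y))
      = exp x * F y * (1 + ((x' - x) + phi y * (y' - y)))"
      by (simp add: F1_eq[OF assms(1)] algebra_simps)
    also have "\<dots> \<le> exp x * F y * exp ((x' - x) + phi y * (y' - y))"
      using F_pos[OF assms(1)] exp_ge_add_one_self by (intro mult_left_mono) auto
    also have "\<dots> = exp x' * (F y * exp (phi y * (y' - y)))"
      by (simp add: exp_add exp_diff)
    also have "\<dots> \<le> exp x' * F y'"
      using tangent(1)[OF assms y'] by simp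
    finally show ?thesis .
  qed
  then show ?thesis
    using assms(1) by (auto simp: subdifferential_def hE_simp)
qed

lemma subgradientD:
  assumes "(u, v) \<in> subdifferential hE (x, y)"
  shows "y \<in> D"
    and "y' \<in> D \<Longrightarrow> exp x * F y + ((x' - x) * u + (y' - y) * v) \<le> exp x' * F y'"
proof -
  show D: "y \<in> D"
    using assms by (auto simp: subdifferential_def hE_simp split: if_splits)
  show "exp x * F y + ((x' - x) * u + (y' - y) * v) \<le> exp x' * F y'" if "y' \<in> D"
  proof -
    have "hE (x, y) + ereal (((x', y') - (x, y)) \<bullet> (u, v)) \<le> hE (x', y')"
      using assms by (simp only: subdifferential_def mem_Collect_eq)
    with that D show ?thesis by (simp add: hE_simp)
  qed
qed

text \<open>The domain contains the whole line in direction \<open>x\<close>, even for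
  \<open>y = - alpha\<close>, so \<open>x\<close> is an unconstrained minimizer of
  \<open>exp t * F y - t * u\<close> and the derivative vanishes.\<close>

lemma subgradient_fst:
  assumes "(u, v) \<in> subdifferential hE (x, y)"
  shows "u = exp x * F y"
proof -
  have y: "y \<in> D" using assms by (rule subgradientD)
  have "((\<lambda>t. exp t * F y - t * u) has_field_derivative (exp x * F y - u)) (at x)"
    by (auto intro!: derivative_eq_intros)
  moreover have "exp x * F y - x * u \<le> exp t * F y - t * u" for t
    using subgradientD(2)[OF assms y, of t] by (simp add: algebra_simps)
  ultimately have "exp x * F y - u = 0"
    by (intro DERIV_local_min[where d = 1]) auto
  then show ?thesis by simp
qed

lemma subgradient_snd:
  assumes "(u, v) \<in> subdifferential hE (x, y)" "y < - alpha"
  shows "v = exp x * F1 y"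
proof -
  obtain b where b: "y < b" "b < - alpha" using dense assms(2) by blast
  have "((\<lambda>t. exp x * F t - t * v) has_field_derivative (exp x * F1 y - v)) (at y)"
    using DERIV_expser[OF in_dom[OF b(2)] b(1)] by (auto intro!: derivative_eq_intros)
  \<comment> \<open>The radius is the distance to the end point, so \<open>t\<close> remains in the
    domain.\<close>
  moreover have "exp x * F y - y * v \<le> exp x * F t - t * v" if "\<bar>y - t\<bar> < - alpha - y" for t
    using subgradientD(2)[OF assms(1), of t x] in_dom that by (simp add: algebra_simps)
  ultimately have "exp x * F1 y - v = 0"
    using assms(2) by (intro DERIV_local_min[where d = "- alpha - y"]) auto
  then show ?thesis by simp
qed

text \<open>At the end point only left difference quotients are available; in the limit they give an
  inequality instead of an equation.\<close>

lemma subgradient_boundary_snd: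
  assumes "(u, v) \<in> subdifferential hE (x, - alpha)" "- alpha \<in> D1"
  shows "exp x * F1 (- alpha) \<le> v"
proof -
  have D: "- alpha \<in> D" using assms(1) by (rule subgradientD)
  have near: "eventually (\<lambda>t. t < - alpha) (at_left (- alpha))"
    by (simp add: eventually_at_filter)
  have "((\<lambda>t. (F t - F (- alpha)) / (t - - alpha)) \<longlongrightarrow> F1 (- alpha)) (at_left (- alpha))"
    using quotient_tendsto_left[OF D] assms(2) by simp
  moreover from near have "eventually (\<lambda>t. (F t - F (- alpha)) / (t - - alpha) \<le> v * exp (- x)) (at_left (- alpha))"
  proof eventually_elim
    case (elim t)
    have "exp x * F (- alpha) + (t - - alpha) * v \<le> exp x * F t"
      using subgradientD(2)[OF assms(1), of t x] in_dom[OF elim] by simp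
    then have "exp (- x) * ((t - - alpha) * v) \<le> exp (- x) * (exp x * (F t - F (- alpha)))"
      by (intro mult_left_mono) (auto simp: algebra_simps)
    also have "\<dots> = F t - F (- alpha)" by (simp add: exp_minus)
    finally show ?case using elim by (simp add: neg_divide_le_eq mult_ac)
  qed
  ultimately have "F1 (- alpha) \<le> v * exp (- x)"
    by (rule tendsto_upperbound) simp
  then have "exp x * F1 (- alpha) \<le> exp x * (v * exp (- x))" by (intro mult_left_mono) auto
  also have "\<dots> = v" by (simp add: exp_minus)
  finally show ?thesis .
qed

text \<open>Since \<open>y' + alpha \<le> 0\<close> on the domain, increasing the second component
  of a subgradient preserves the defining inequality: the half-line is the normal cone of the
  domain.\<close>

lemma subdifferential_boundary:
  assumes "- alpha \<in> D" "- alpha \<in> D1"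
  shows "subdifferential hE (x, - alpha) = {exp x * F (- alpha)} \<times> {exp x * F1 (- alpha)..}"
proof -
  have "(exp x * F (- alpha), v) \<in> subdifferential hE (x, - alpha)" if v: "exp x * F1 (- alpha) \<le> v" for v
  proof -
    note sub = subgradientD(2)[OF subgradient[OF assms, of x]]
    have "exp x * F (- alpha) + ((x' - x) * (exp x * F (- alpha)) + (y' - - alpha) * v) \<le> exp x' * F y'"
      if y': "y' \<in> D" for x' y'
    proof -
      have "(y' - - alpha) * v \<le> (y' - - alpha) * (exp x * F1 (- alpha))"
        using dom_le[OF y'] v by (intro mult_left_mono_neg) auto
      with sub[OF y', of x'] show ?thesis by linarith
    qed
    then show ?thesis
      using assms(1) by (auto simp: subdifferential_def hE_simp)
  qed
  then show ?thesis
    using subgradient_fst subgradient_boundary_snd assms(2) by auto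
qed

lemma subdifferential_interior:
  assumes "y < - alpha"
  shows "subdifferential hE (x, y) = {(exp x * F y, exp x * F1 y)}"
proof -
  have "subdifferential hE (x, y) \<subseteq> {(exp x * F y, exp x * F1 y)}"
    using subgradient_fst subgradient_snd assms by auto
  then show ?thesis using subgradient in_dom in_dom1 assms by blast
qed

text \<open>The ratio of the components is \<open>phi y\<close> and determines \<open>y\<close>; the
  scale \<open>exp x\<close> is then fixed by \<open>x = ln (u / F y)\<close>.\<close>

lemma gradient_range:
  "(\<lambda>(x, y). (exp x * F y, exp x * F1 y)) ` (UNIV \<times> {..<- alpha})
    = {(u, v). 0 < u \<and> t1 * u < v \<and> ereal v < t2 * ereal u}"
proof -
  have iff: "t1 * u < v \<and> ereal v < t2 * ereal u \<longleftrightarrow> t1 < v / u \<and> ereal (v / u) < t2" if "0 < u" for u v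
    using that by (cases t2) (auto simp: pos_less_divide_eq pos_divide_less_eq)
  show ?thesis
  proof (intro equalityI subsetI)
    fix w assume "w \<in> (\<lambda>(x, y). (exp x * F y, exp x * F1 y)) ` (UNIV \<times> {..<- alpha})"
    then obtain x y where w: "w = (exp x * F y, exp x * F1 y)" "y < - alpha" by auto
    have "0 < exp x * F y" using F_pos in_dom w by simp
    moreover have "exp x * F1 y / (exp x * F y) = phi y" by (simp add: phi_def)
    ultimately show "w \<in> {(u, v). 0 < u \<and> t1 * u < v \<and> ereal v < t2 * ereal u}"
      using iff t1_less_phi phi_less_t2 in_dom in_dom1 w by simp
  next
    fix w assume "w \<in> {(u, v). 0 < u \<and> t1 * u < v \<and> ereal v < t2 * ereal u}"
    then obtain u v where w: "w = (u, v)" "0 < u" "t1 < v / u" "ereal (v / u) < t2"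
      using iff by auto
    then obtain y where y: "y < - alpha" "phi y = v / u" using phi_surj by metis
    have Fy: "0 < F y" using F_pos in_dom y by simp
    have "exp (ln (u / F y)) * F y = u" using w(2) Fy by simp
    moreover have "exp (ln (u / F y)) * F1 y = v"
      using w(2) Fy y by (simp add: F1_eq[OF in_dom])
    ultimately show "w \<in> (\<lambda>(x, y). (exp x * F y, exp x * F1 y)) ` (UNIV \<times> {..<- alpha})"
      using y(1) w(1) by (intro image_eqI[where x = "(ln (u / F y), y)"]) auto
  qed
qed

section \<open>Conjugates of \<open>ln f\<close> and \<open>h\<close>\<close>

lemma conj_lnfE_le_iff:
  "conjugate lnfE w \<le> ereal r \<longleftrightarrow> (\<forall>z\<in>D. z * w - ln (F z) \<le> r)"
  unfolding conjugate_def SUP_le_iff by (auto simp: lnfE_def)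

lemma conj_hE_le_iff:
  "conjugate hE (u, v) \<le> ereal r \<longleftrightarrow> (\<forall>x. \<forall>y\<in>D. x * u + y * v - exp x * F y \<le> r)"
  unfolding conjugate_def SUP_le_iff by (auto simp: hE_simp)

lemma conj_lnfE_less_t1:
  assumes "w < t1"
  shows "conjugate lnfE w = \<infinity>"
proof (rule ereal_eq_infinityI)
  fix r
  obtain b where b: "b \<in> D" using dom_nonempty by blast
  \<comment> \<open>Far enough to the left that the lower bound
    \<open>z * (w - t1) + t1 * b - ln (F b)\<close> of the objective is at least
    \<open>r + 1\<close>; the division reverses the order as \<open>w < t1\<close>.\<close>
  define z where "z = min b ((r + 1 - t1 * b + ln (F b)) / (w - t1))"
  have z: "z \<le> b" "z \<in> D" using b expdom_mono by (auto simp: z_def)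
  have "ln (F z) \<le> ln (exp (t1 * (z - b)) * F b)"
    using F_upper[OF b z(1)] F_pos[OF z(2)] F_pos[OF b] by (subst ln_le_cancel_iff) auto
  also have "\<dots> = t1 * (z - b) + ln (F b)"
    using F_pos[OF b] by (simp add: ln_mult)
  finally have "z * (w - t1) + t1 * b - ln (F b) \<le> z * w - ln (F z)"
    by (simp add: algebra_simps)
  moreover have "z \<le> (r + 1 - t1 * b + ln (F b)) / (w - t1)" by (simp add: z_def)
  then have "r + 1 - t1 * b + ln (F b) \<le> z * (w - t1)"
    using assms by (simp add: neg_le_divide_eq)
  ultimately have "r < z * w - ln (F z)" by linarith
  with z(2) show "\<not> conjugate lnfE w \<le> ereal r"
    by (auto simp: conj_lnfE_le_iff not_le)
qed

text \<open>\<open>F_lower\<close> bounds the objective by \<open>- ln P\<close> everywhere, and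
  \<open>F_upper_near\<close> provides points that come arbitrarily close.\<close>

lemma conj_lnfE_t1: "conjugate lnfE t1 = ereal (- ln P)"
proof (rule ereal_eqI_real_upper_bounds)
  fix r
  have "(\<forall>z\<in>D. z * t1 - ln (F z) \<le> r) \<longleftrightarrow> - ln P \<le> r"
  proof
    assume r: "\<forall>z\<in>D. z * t1 - ln (F z) \<le> r"
    have "exp (- r) \<le> P"
    proof (rule field_le_epsilon)
      fix e :: real assume "0 < e"
      obtain z where z: "z < - alpha" "F z \<le> (P + e) * exp (t1 * z)"
        using F_upper_near[OF \<open>0 < e\<close>] .
      have "exp (- r) * exp (z * t1) \<le> exp (ln (F z))"
        using r in_dom[OF z(1)] unfolding exp_add[symmetric] by force
      also have "\<dots> = F z" using F_pos[OF in_dom[OF z(1)]] by simp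
      also note z(2)
      finally show "exp (- r) \<le> P + e" by (simp add: mult.commute)
    qed
    then show "- ln P \<le> r" using P_pos ln_ge_iff[of P "- r"] by linarith
  next
    assume r: "- ln P \<le> r"
    show "\<forall>z\<in>D. z * t1 - ln (F z) \<le> r"
    proof
      fix z assume z: "z \<in> D"
      have "ln P + t1 * z = ln (P * exp (t1 * z))" using P_pos by (simp add: ln_mult)
      also have "\<dots> \<le> ln (F z)"
        using F_lower[OF z] F_pos[OF z] P_pos by (subst ln_le_cancel_iff) auto
      finally show "z * t1 - ln (F z) \<le> r" using r by (simp add: mult.commute)
    qed
  qed
  then show "conjugate lnfE t1 \<le> ereal r \<longleftrightarrow> ereal (- ln P) \<le> ereal r"
    by (simp add: conj_lnfE_le_iff)
qed

text \<open>The sign condition is the variational inequality for a maximum at \<open>y\<close>. It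
  holds for \<open>w = phi y\<close>, and at \<open>y = - alpha\<close> for every
  \<open>w \<ge> phi (- alpha)\<close>.\<close>

lemma conj_lnfE_attained:
  assumes y: "y \<in> D" "y \<in> D1" and w: "\<And>z. z \<in> D \<Longrightarrow> (w - phi y) * (z - y) \<le> 0"
  shows "conjugate lnfE w = ereal (y * w - ln (F y))"
proof (rule ereal_eqI_real_upper_bounds)
  fix r
  have "z * w - ln (F z) \<le> y * w - ln (F y)" if z: "z \<in> D" for z
    using ln_tangent(1)[OF y z] w[OF z] by (simp add: algebra_simps)
  then show "conjugate lnfE w \<le> ereal r \<longleftrightarrow> ereal (y * w - ln (F y)) \<le> ereal r"
    unfolding conj_lnfE_le_iff using y(1) by (auto intro: order_trans)
qed

lemma conj_lnfE_phi:
  assumes "y < - alpha"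
  shows "conjugate lnfE (phi y) = ereal (y * phi y - ln (F y))"
  using assms in_dom in_dom1 by (intro conj_lnfE_attained) auto

lemma conj_lnfE_ge_t2:
  assumes "t2 \<le> ereal w"
  shows "conjugate lnfE w = ereal (- alpha * w - ln (F (- alpha)))"
    and "- alpha \<in> D" "- alpha \<in> D1"
proof -
  have "t2 < \<infinity>" using assms by (cases t2) auto
  then show D: "- alpha \<in> D" "- alpha \<in> D1" using t2_finite_iff by blast+
  then have "phi (- alpha) \<le> w" using assms at_left_phi by simp
  then show "conjugate lnfE w = ereal (- alpha * w - ln (F (- alpha)))"
    using D by (intro conj_lnfE_attained) (auto intro!: mult_nonneg_nonpos dest: dom_le)
qed

lemma conj_lnfE_finite: "conjugate lnfE w < \<infinity> \<longleftrightarrow> t1 \<le> w"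
proof -
  consider "w < t1" | "w = t1" | "t1 < w" "ereal w < t2" | "t2 \<le> ereal w" by fastforce
  then show ?thesis
  proof cases
    case 3
    then obtain y where "y < - alpha" "phi y = w" by (rule phi_surj)
    then show ?thesis using 3 conj_lnfE_phi by auto
  next
    case 4
    then have "ereal t1 < ereal w" using t1_less_t2 by (rule less_le_trans[rotated])
    then show ?thesis using conj_lnfE_ge_t2(1)[OF 4] by auto
  qed (simp_all add: conj_lnfE_less_t1 conj_lnfE_t1)
qed

text \<open>For fixed \<open>y\<close> the supremum over \<open>x\<close> is explicit, with
  maximizer \<open>ln (u / F y)\<close>. What remains is \<open>u\<close> times the supremum
  defining the conjugate of \<open>ln f\<close> at \<open>v / u\<close>.\<close>

lemma conj_hE_pos:
  assumes "0 < u"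
  shows "conjugate hE (u, v) = ereal (u * ln u - u) + ereal u * conjugate lnfE (v / u)"
proof (rule ereal_eqI_real_upper_bounds)
  fix r
  let ?c = "u * ln u - u"
  have "(\<forall>x. \<forall>y\<in>D. x * u + y * v - exp x * F y \<le> r) \<longleftrightarrow>
    (\<forall>y\<in>D. y * (v / u) - ln (F y) \<le> (r - ?c) / u)"
  proof safe
    fix y assume y: "y \<in> D" and "\<forall>x. \<forall>y\<in>D. x * u + y * v - exp x * F y \<le> r"
    then have "ln (u / F y) * u + y * v - exp (ln (u / F y)) * F y \<le> r" by blast
    moreover have "exp (ln (u / F y)) * F y = u" using F_pos[OF y] assms by simp
    ultimately have "u * ln u - u * ln (F y) + y * v - u \<le> r"
      using F_pos[OF y] assms by (simp add: ln_div algebra_simps)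
    then show "y * (v / u) - ln (F y) \<le> (r - ?c) / u"
      using assms by (simp add: pos_le_divide_eq left_diff_distrib) (simp add: algebra_simps)
  next
    fix x y assume y: "y \<in> D" and "\<forall>y\<in>D. y * (v / u) - ln (F y) \<le> (r - ?c) / u"
    then have "y * (v / u) - ln (F y) \<le> (r - ?c) / u" by blast
    then have "y * v - u * ln (F y) \<le> r - ?c"
      using assms by (simp add: pos_le_divide_eq left_diff_distrib) (simp add: algebra_simps)
    then show "x * u + y * v - exp x * F y \<le> r"
      using exp_conjugate_le[OF assms F_pos[OF y], of x] by linarith
  qed
  moreover have "ereal ?c + ereal u * B \<le> ereal r \<longleftrightarrow> B \<le> ereal ((r - ?c) / u)" for B
    using assms by (cases B) (auto simp: field_simps)
  ultimately show "conjugate hE (u, v) \<le> ereal r \<longleftrightarrow>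
    ereal ?c + ereal u * conjugate lnfE (v / u) \<le> ereal r"
    by (simp only: conj_hE_le_iff conj_lnfE_le_iff)
qed

lemma conj_hE_zero:
  assumes "0 \<le> v"
  shows "conjugate hE (0, v) = ereal (- alpha * v)"
proof (rule ereal_eqI_real_upper_bounds)
  fix r
  have "(\<forall>x. \<forall>y\<in>D. x * 0 + y * v - exp x * F y \<le> r) \<longleftrightarrow> - alpha * v \<le> r"
  proof
    assume r: "- alpha * v \<le> r"
    show "\<forall>x. \<forall>y\<in>D. x * 0 + y * v - exp x * F y \<le> r"
    proof (intro allI ballI)
      fix x y assume y: "y \<in> D"
      have "y * v \<le> - alpha * v" using dom_le[OF y] assms by (rule mult_right_mono)
      moreover have "0 \<le> exp x * F y" using F_pos[OF y] by simp
      ultimately show "x * 0 + y * v - exp x * F y \<le> r" using r by linarith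
    qed
  next
    assume r: "\<forall>x. \<forall>y\<in>D. x * 0 + y * v - exp x * F y \<le> r"
    have yv: "y * v \<le> r" if y: "y \<in> D" for y
    proof (rule field_le_epsilon)
      fix e :: real assume "0 < e"
      \<comment> \<open>With \<open>u = 0\<close> the variable \<open>x\<close> costs nothing, so
        the subtracted value of \<open>h\<close> can be made an arbitrarily small
        \<open>e\<close>.\<close>
      then have "exp (ln (e / F y)) * F y = e" using F_pos[OF y] by simp
      with r y show "y * v \<le> r + e" by (metis add_0 diff_le_eq mult_zero_right)
    qed
    show "- alpha * v \<le> r"
    proof (rule tendsto_upperbound)
      show "((\<lambda>y. y * v) \<longlongrightarrow> - alpha * v) (at_left (- alpha))" by (intro tendsto_intros)
      show "eventually (\<lambda>y. y * v \<le> r) (at_left (- alpha))"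
        using yv in_dom by (simp add: eventually_at_filter)
    qed simp
  qed
  then show "conjugate hE (0, v) \<le> ereal r \<longleftrightarrow> ereal (- alpha * v) \<le> ereal r"
    by (simp add: conj_hE_le_iff)
qed

text \<open>The objective is unbounded as \<open>x\<close> tends to minus infinity if
  \<open>u < 0\<close>, and otherwise as \<open>y\<close> does. Along both directions
  \<open>h\<close> stays bounded, and the witnesses lift the objective to at least
  \<open>r + 1\<close>.\<close>

lemma conj_hE_neg:
  assumes "u < 0 \<or> u = 0 \<and> v < 0"
  shows "conjugate hE (u, v) = \<infinity>"
proof (rule ereal_eq_infinityI)
  fix r
  obtain b where b: "b \<in> D" using dom_nonempty by blast
  show "\<not> conjugate hE (u, v) \<le> ereal r"
  proof
    assume "conjugate hE (u, v) \<le> ereal r"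
    then have r: "x * u + y * v - exp x * F y \<le> r" if "y \<in> D" for x y
      using that by (simp add: conj_hE_le_iff)
    show False
    proof (cases "u < 0")
      case True
      define x where "x = min 0 ((r + 1 - b * v + F b) / u)"
      have "exp x * F b \<le> 1 * F b" using F_pos[OF b] by (intro mult_right_mono) (auto simp: x_def)
      moreover have "x \<le> (r + 1 - b * v + F b) / u" by (simp add: x_def)
      then have "r + 1 - b * v + F b \<le> x * u" using True by (simp add: neg_le_divide_eq)
      ultimately show False using r[OF b, of x] by linarith
    next
      case False
      then have uv: "u = 0" "v < 0" using assms by auto
      define y where "y = min b ((r + 1 + F b) / v)"
      have y: "y \<in> D" using expdom_mono[OF b] by (simp add: y_def)
      have "F y \<le> F b" using F_strict_mono[OF b, of y] by (auto simp: y_def min_def)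
      moreover have "y \<le> (r + 1 + F b) / v" by (simp add: y_def)
      then have "r + 1 + F b \<le> y * v" using uv by (simp add: neg_le_divide_eq)
      ultimately show False using r[OF y, of 0] uv by simp
    qed
  qed
qed

lemma edom_conj_hE: "edom (conjugate hE) = {(u, v). v \<ge> t1 * u \<and> t1 * u \<ge> 0}"
proof -
  have "conjugate hE (u, v) < \<infinity> \<longleftrightarrow> v \<ge> t1 * u \<and> t1 * u \<ge> 0" for u v
  proof -
    consider "0 < u" | "u = 0" "0 \<le> v" | "u < 0 \<or> u = 0 \<and> v < 0" by linarith
    then show ?thesis
    proof cases
      case 1
      have "conjugate hE (u, v) < \<infinity> \<longleftrightarrow> conjugate lnfE (v / u) < \<infinity>"
        unfolding conj_hE_pos[OF 1] using 1 by (cases "conjugate lnfE (v / u)") auto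
      also have "\<dots> \<longleftrightarrow> t1 \<le> v / u" by (rule conj_lnfE_finite)
      finally show ?thesis using 1 t1_pos by (simp add: pos_le_divide_eq)
    next
      case 2
      then show ?thesis using conj_hE_zero by simp
    next
      case 3
      then show ?thesis using conj_hE_neg[OF 3] t1_pos by (auto simp: zero_le_mult_iff)
    qed
  qed
  then show ?thesis by (auto simp: edom_def)
qed

subsection \<open>Entropy minimization\<close>

text \<open>Finite sums are defined beyond \<open>- alpha\<close>. At \<open>- alpha\<close> their
  logarithmic derivatives tend to \<open>phi (- alpha) < w\<close>; at \<open>- alpha + e\<close>,
  outside the domain, the sums are unbounded in \<open>N\<close>, which forces the derivative up to
  \<open>w\<close>. The root comes from the intermediate value theorem.\<close>

lemma truncated_root:
  assumes D: "- alpha \<in> D" "- alpha \<in> D1" and w: "phi (- alpha) < w" and e: "0 < e"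
  shows "\<forall>\<^sub>F N in sequentially. \<exists>y\<ge>- alpha. y \<le> - alpha + e \<and>
    (\<Sum>n<N. a n * s n * exp (s n * y)) = w * (\<Sum>n<N. a n * exp (s n * y))"
proof -
  let ?FN = "\<lambda>N y. \<Sum>n<N. a n * exp (s n * y)"
  let ?GN = "\<lambda>N y. \<Sum>n<N. a n * s n * exp (s n * y)"
  let ?y = "- alpha + e"
  have "F1 (- alpha) < w * F (- alpha)"
    using w F_pos[OF D(1)] by (simp add: phi_def pos_divide_less_eq)
  moreover have "(\<lambda>N. w * ?FN N (- alpha) - ?GN N (- alpha)) \<longlonglongrightarrow> w * F (- alpha) - F1 (- alpha)"
    using expser_sums[OF D(1)] expser_sums[OF D(2)] unfolding sums_def by (intro tendsto_intros)
  ultimately have left: "\<forall>\<^sub>F N in sequentially. 0 < w * ?FN N (- alpha) - ?GN N (- alpha)"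
    by (intro order_tendstoD) auto
  \<comment> \<open>The largest value that a truncated sum could have at \<open>?y\<close> if its
    logarithmic derivative there were below \<open>w\<close>.\<close>
  let ?C = "F (- alpha) * exp (w * e)"
  have "?y \<notin> D" using e dom_le by fastforce
  then obtain N0 where N0: "?C < ?FN N0 ?y"
    using expdom_bounded_sums[of ?y ?C] by (meson not_le)
  have right: "w * ?FN N ?y \<le> ?GN N ?y" if "N \<ge> N0" for N
  proof (rule ccontr)
    assume less: "\<not> ?thesis"
    have "?FN N0 ?y \<le> ?FN N ?y"
      using that a_nonneg by (intro sum_mono2) auto
    with N0 have big: "?C < ?FN N ?y" by linarith
    have FN_pos: "0 < ?FN N ?y"
      using big F_pos[OF D(1)] by (smt (verit) exp_gt_zero mult_pos_pos)
    \<comment> \<open>With zero weights from \<open>N\<close> on, the finite sum is an exponential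
      series converging everywhere, and \<open>expser_tangent\<close> applies to it.\<close>
    define b where "b n = (if n < N then a n else 0)" for n
    interpret B: exp_series b s
      by unfold_locales (auto simp: b_def a_nonneg s_pos)
    have sb: "(\<lambda>n. b n * exp (s n * z)) sums ?FN N z" for z
      using sums_If_finite_set[of "{..<N}" "\<lambda>n. a n * exp (s n * z)"]
      by (simp add: b_def if_distrib[of "\<lambda>x. x * _"] cong: if_cong)
    have sb1: "(\<lambda>n. b n * s n * exp (s n * z)) sums ?GN N z" for z
      using sums_If_finite_set[of "{..<N}" "\<lambda>n. a n * s n * exp (s n * z)"]
      by (simp add: b_def if_distrib[of "\<lambda>x. x * _"] cong: if_cong)
    have eqs: "expser b s z = ?FN N z" "expser (\<lambda>n. b n * s n) s z = ?GN N z"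
      "z \<in> expdom b s" "z \<in> expdom (\<lambda>n. b n * s n) s" for z
      using sb sb1 by (auto simp: expser_def expdom_def sums_iff)
    let ?k = "?GN N ?y / ?FN N ?y"
    have "?FN N ?y * exp (?k * (- alpha - ?y)) \<le> ?FN N (- alpha)"
      using B.expser_tangent(1)[of ?y "- alpha" ?k] FN_pos by (simp add: eqs)
    also have "\<dots> \<le> F (- alpha)" using D(1) by (rule sum_le_expser)
    finally have "?FN N ?y * exp (?k * (- alpha - ?y)) * exp (?k * e) \<le> F (- alpha) * exp (?k * e)"
      by (rule mult_right_mono) simp
    moreover have "exp (?k * (- alpha - ?y)) * exp (?k * e) = 1"
      unfolding exp_add[symmetric] by simp
    ultimately have "?FN N ?y \<le> F (- alpha) * exp (?k * e)" by (simp only: mult.assoc mult_1_right)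
    also have "\<dots> \<le> ?C"
    proof -
      have "?k \<le> w" using less FN_pos by (simp add: pos_divide_le_eq)
      then have "?k * e \<le> w * e" using e by (intro mult_right_mono) auto
      then have "exp (?k * e) \<le> exp (w * e)" by (simp only: exp_le_cancel_iff)
      then show ?thesis using F_pos[OF D(1)] by (intro mult_left_mono) auto
    qed
    finally show False using big by linarith
  qed
  from left eventually_ge_at_top[of N0] show ?thesis
  proof eventually_elim
    case (elim N)
    have "continuous_on {- alpha..?y} (\<lambda>y. ?GN N y - w * ?FN N y)"
      by (intro continuous_intros)
    then obtain y where "- alpha \<le> y" "y \<le> ?y" "?GN N y - w * ?FN N y = 0"
      using IVT'[of "\<lambda>y. ?GN N y - w * ?FN N y" "- alpha" 0 ?y] elim(1) right[OF elim(2)] e by auto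
    then show ?case by (intro exI[of _ y]) auto
  qed
qed

end

section \<open>The minimization problem with indices from 1\<close>

locale mb_setup =
  fixes p \<sigma> :: "nat \<Rightarrow> real"
  assumes p_ge_1: "n \<ge> 1 \<Longrightarrow> p n \<ge> 1"
    and sigma_pos: "n \<ge> 1 \<Longrightarrow> \<sigma> n > 0"
    and sigma_lim: "filterlim \<sigma> at_top sequentially"
    and dom_h: "edom (h_series p \<sigma>) \<noteq> {}"
begin

lemma p_pos: "n \<ge> 1 \<Longrightarrow> 0 < p n"
  using p_ge_1[of n] by linarith

text \<open>The series of the statement start at 1, those of the analytic part at 0; the shift by
  \<open>Suc\<close> also discards the irrelevant values at 0.\<close>

sublocale mb_series "\<lambda>n. p (Suc n)" "\<lambda>n. \<sigma> (Suc n)"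
proof
  show "filterlim (\<lambda>n. \<sigma> (Suc n)) at_top sequentially"
    using sigma_lim filterlim_sequentially_Suc by blast
  obtain x y where "h_series p \<sigma> (x, y) < \<infinity>"
    using dom_h by (auto simp: edom_def)
  then have "summable (\<lambda>n. p (Suc n) * exp (x + \<sigma> (Suc n) * y))"
    using eseries_nonneg[of "\<lambda>n. p n * exp (x + \<sigma> n * y)"] p_pos
    by (auto simp: h_series_def h_term_def less_imp_le split: if_splits)
  then have "summable (\<lambda>n. p (Suc n) * exp (x + \<sigma> (Suc n) * y) * exp (- x))"
    by (rule summable_mult2)
  moreover have "exp (x + c) * exp (- x) = exp c" for c :: real
    unfolding exp_add[symmetric] by simp
  ultimately show "expdom (\<lambda>n. p (Suc n)) (\<lambda>n. \<sigma> (Suc n)) \<noteq> {}"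
    by (auto simp: expdom_def mult.assoc)
qed (use p_ge_1 p_pos sigma_pos in \<open>auto simp: less_imp_le\<close>)

lemma f_series_eq: "f_series p \<sigma> = fE"
proof
  fix y show "f_series p \<sigma> y = fE y"
    using eseries_nonneg[of "\<lambda>n. p n * exp (\<sigma> n * y)"] p_pos
    by (simp add: f_series_def fE_def expdom_def expser_def less_imp_le)
qed

lemma h_series_eq: "h_series p \<sigma> = hE"
proof
  fix z :: "real \<times> real"
  obtain x y where z: "z = (x, y)" by (cases z)
  have eq: "p n * exp (x + \<sigma> n * y) = exp x * (p n * exp (\<sigma> n * y))" for n
    by (simp add: exp_add)
  have "summable (\<lambda>n. exp x * (p (Suc n) * exp (\<sigma> (Suc n) * y))) \<longleftrightarrow> y \<in> D"
    unfolding expdom_def by (subst summable_cmult_iff) auto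
  then show "h_series p \<sigma> z = hE z"
    using eseries_nonneg[of "\<lambda>n. exp x * (p n * exp (\<sigma> n * y))"] p_pos
    by (auto simp: z h_series_def h_term_def eq hE_simp expser_def expdom_def less_imp_le suminf_mult)
qed

lemma t1_eq: "(LEAST s. s \<in> \<sigma> ` {1..}) = t1"
  unfolding t1_def image_from_1 ..

lemma Suc_M: "{n. n \<ge> 1 \<and> \<sigma> n = t1} = Suc ` M"
proof -
  have "n \<in> Suc ` M" if "n \<ge> 1" "\<sigma> n = t1" for n
    using that by (cases n) (auto simp: M_def)
  then show ?thesis by (auto simp: M_def)
qed

lemma sum_Suc_M: "(\<Sum>n\<in>{n. n \<ge> 1 \<and> \<sigma> n = t1}. p n) = P"
  unfolding Suc_M P_def by (subst sum.reindex) auto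

lemma S_iff: "w \<in> S \<sigma> u v \<longleftrightarrow> (\<forall>n\<ge>1. 0 \<le> w n) \<and> (\<lambda>n. w (Suc n)) sums u \<and>
    (\<lambda>n. \<sigma> (Suc n) * w (Suc n)) sums v"
proof (cases "\<forall>n\<ge>1. 0 \<le> w n")
  case True
  then show ?thesis
    using eseries_nonneg_eq_iff[of w u] eseries_nonneg_eq_iff[of "\<lambda>n. \<sigma> n * w n" v] sigma_pos
    by (simp add: S_def less_imp_le)
qed (auto simp: S_def)

lemma H_eq: "H p \<sigma> u v = (INF w\<in>S \<sigma> u v. entropy_sum p w)"
  unfolding H_def
proof (rule INF_cong)
  fix w assume "w \<in> S \<sigma> u v"
  then have w: "0 \<le> w n" if "n \<ge> 1" for n using that by (simp add: S_iff)
  show "eseries (\<lambda>n. ereal (p n) * E_MB (w n / p n)) = entropy_sum p w"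
    unfolding entropy_sum_def
  proof (rule eseries_cong)
    fix n :: nat assume n: "n \<ge> 1"
    have "0 \<le> w n / p n" using w[OF n] p_pos[OF n] by simp
    then show "ereal (p n) * E_MB (w n / p n) = ereal (w n * (ln (w n / p n) - 1))"
      using p_pos[OF n] by (simp add: E_MB_def)
  qed
qed simp

text \<open>\<open>z\<close> is the logarithmic density of the reference \<open>q\<close> with
  respect to \<open>p\<close>. Termwise, the entropy is \<open>(w z - q) + gap w q\<close>: a part
  with known sum plus a nonnegative remainder. Letting \<open>q\<close> vanish where
  \<open>w\<close> does accommodates the minimizer for \<open>v = \<theta>1 u\<close>, supported on
  \<open>\<Sigma>\<close>.\<close>

lemma entropy_sum_reference:
  assumes w: "\<And>n. n \<ge> 1 \<Longrightarrow> 0 \<le> w n" and q: "\<And>n. n \<ge> 1 \<Longrightarrow> 0 \<le> q n"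
    and qz: "\<And>n. n \<ge> 1 \<Longrightarrow> q n \<noteq> 0 \<Longrightarrow> q n = p n * exp (z n)"
    and qw: "\<And>n. n \<ge> 1 \<Longrightarrow> q n = 0 \<Longrightarrow> w n = 0"
    and c: "(\<lambda>n. w (Suc n) * z (Suc n)) sums c" and d: "(\<lambda>n. q (Suc n)) sums d"
  shows "entropy_sum p w = ereal (c - d) + eseries (\<lambda>n. ereal (gap (w n) (q n)))"
    and "0 \<le> eseries (\<lambda>n. ereal (gap (w n) (q n)))"
    and "eseries (\<lambda>n. ereal (gap (w n) (q n))) = 0 \<longleftrightarrow> (\<forall>n\<ge>1. w n = q n)"
proof -
  have nonneg: "0 \<le> gap (w n) (q n)" if n: "n \<ge> 1" for n
    using gap_nonneg[of "w n" "q n"] w[OF n] q[OF n] qw[OF n] gap_self[of "q n"] by (cases "q n = 0") auto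
  have zero: "gap (w n) (q n) = 0 \<longleftrightarrow> w n = q n" if n: "n \<ge> 1" for n
    using gap_pos[of "w n" "q n"] w[OF n] q[OF n] qw[OF n] gap_self[of "q n"]
    by (cases "q n = 0"; cases "w n = q n") auto
  have eq: "w n * (ln (w n / p n) - 1) = (w n * z n - q n) + gap (w n) (q n)" if n: "n \<ge> 1" for n
  proof (cases "w n = 0")
    case False
    then have pos: "0 < w n" "0 < q n" "0 < p n"
      using w[OF n] q[OF n] qw[OF n] p_pos[OF n] by (auto simp: less_le)
    then have "ln (q n) = ln (p n) + z n" using qz[OF n] by (simp add: ln_mult)
    with pos show ?thesis by (simp add: gap_def ln_div algebra_simps)
  qed (simp add: gap_def)
  have "entropy_sum p w = eseries (\<lambda>n. ereal ((w n * z n - q n) + gap (w n) (q n)))"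
    unfolding entropy_sum_def by (rule eseries_cong) (simp add: eq)
  also have "\<dots> = ereal (c - d) + eseries (\<lambda>n. ereal (gap (w n) (q n)))"
    using nonneg by (intro eseries_add sums_diff c d) auto
  finally show "entropy_sum p w = ereal (c - d) + eseries (\<lambda>n. ereal (gap (w n) (q n)))" .
  show "0 \<le> eseries (\<lambda>n. ereal (gap (w n) (q n)))"
    using nonneg by (intro eseries_ge_0) auto
  show "eseries (\<lambda>n. ereal (gap (w n) (q n))) = 0 \<longleftrightarrow> (\<forall>n\<ge>1. w n = q n)"
    using nonneg zero by (subst eseries_eq_0_iff) auto
qed

section \<open>Explicit minimizers\<close>

definition min_at :: "real \<Rightarrow> real \<Rightarrow> (nat \<Rightarrow> real) \<Rightarrow> bool" where
  "min_at u v q \<longleftrightarrow> q \<in> S \<sigma> u v \<and> conjugate hE (u, v) = entropy_sum p q \<and>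
     (\<forall>w\<in>S \<sigma> u v. entropy_sum p q \<le> entropy_sum p w \<and>
        (entropy_sum p w = entropy_sum p q \<longrightarrow> (\<forall>n\<ge>1. w n = q n)))"

text \<open>The essential hypothesis is that \<open>w\<close> paired with \<open>z\<close> has the
  same sum \<open>c\<close> for all feasible \<open>w\<close>. Then the entropy differs from its
  \<open>gap\<close> series by a constant, and that series is least exactly at
  \<open>q\<close>.\<close>

lemma min_atI:
  assumes q: "q \<in> S \<sigma> u v"
    and qz: "\<And>n. n \<ge> 1 \<Longrightarrow> q n \<noteq> 0 \<Longrightarrow> q n = p n * exp (z n)"
    and qw: "\<And>w n. w \<in> S \<sigma> u v \<Longrightarrow> n \<ge> 1 \<Longrightarrow> q n = 0 \<Longrightarrow> w n = 0"
    and c: "\<And>w. w \<in> S \<sigma> u v \<Longrightarrow> (\<lambda>n. w (Suc n) * z (Suc n)) sums c"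
    and conj: "conjugate hE (u, v) = ereal (c - u)"
  shows "min_at u v q"
proof -
  have S: "\<And>w n. w \<in> S \<sigma> u v \<Longrightarrow> n \<ge> 1 \<Longrightarrow> 0 \<le> w n" "(\<lambda>n. q (Suc n)) sums u"
    using q by (auto simp: S_iff)
  have ref: "entropy_sum p w = ereal (c - u) + eseries (\<lambda>n. ereal (gap (w n) (q n)))"
    "0 \<le> eseries (\<lambda>n. ereal (gap (w n) (q n)))"
    "eseries (\<lambda>n. ereal (gap (w n) (q n))) = 0 \<longleftrightarrow> (\<forall>n\<ge>1. w n = q n)"
    if w: "w \<in> S \<sigma> u v" for w
    using entropy_sum_reference[OF S(1)[OF w] S(1)[OF q] qz qw[OF w] c[OF w] S(2)] by blast+
  have val: "entropy_sum p q = ereal (c - u)" using ref(1)[OF q] ref(3)[OF q] by simp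
  have "entropy_sum p q \<le> entropy_sum p w \<and> (entropy_sum p w = entropy_sum p q \<longrightarrow> (\<forall>n\<ge>1. w n = q n))"
    if w: "w \<in> S \<sigma> u v" for w
    unfolding val ref(1)[OF w] ref(3)[OF w, symmetric] using ref(2)[OF w]
    by (cases "eseries (\<lambda>n. ereal (gap (w n) (q n)))") auto
  then show ?thesis using q val conj by (simp add: min_at_def)
qed

lemma is_arg_min_entropy:
  "is_arg_min (entropy_sum p) (\<lambda>w. w \<in> S \<sigma> u v) w \<longleftrightarrow>
    w \<in> S \<sigma> u v \<and> (\<forall>w'\<in>S \<sigma> u v. entropy_sum p w \<le> entropy_sum p w')"
  by (auto simp: is_arg_min_def not_less)

lemma min_at_imp:
  assumes "min_at u v q"
  shows "is_arg_min (entropy_sum p) (\<lambda>w. w \<in> S \<sigma> u v) q"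
    and "conjugate hE (u, v) = entropy_sum p q"
    and "conjugate hE (u, v) = H p \<sigma> u v"
    and "is_arg_min (entropy_sum p) (\<lambda>w. w \<in> S \<sigma> u v) w \<Longrightarrow> n \<ge> 1 \<Longrightarrow> w n = q n"
proof -
  note q = assms[unfolded min_at_def]
  show "is_arg_min (entropy_sum p) (\<lambda>w. w \<in> S \<sigma> u v) q"
    using q by (simp add: is_arg_min_entropy)
  show "conjugate hE (u, v) = entropy_sum p q" using q by simp
  have "H p \<sigma> u v = entropy_sum p q"
    unfolding H_eq using q by (intro antisym INF_lower INF_greatest) auto
  then show "conjugate hE (u, v) = H p \<sigma> u v" using q by simp
  show "w n = q n" if "is_arg_min (entropy_sum p) (\<lambda>w. w \<in> S \<sigma> u v) w" "n \<ge> 1"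
    using that q unfolding is_arg_min_entropy by (metis antisym)
qed

lemma S_zero:
  assumes "w \<in> S \<sigma> 0 v"
  shows "n \<ge> 1 \<Longrightarrow> w n = 0" and "v = 0"
proof -
  have sums: "(\<lambda>n. w (Suc n)) sums 0" "(\<lambda>n. \<sigma> (Suc n) * w (Suc n)) sums v"
    and nonneg: "\<And>n. 0 \<le> w (Suc n)"
    using assms by (auto simp: S_iff)
  then have zero: "w (Suc n) = 0" for n
    using suminf_eq_zero_iff[of "\<lambda>n. w (Suc n)"] by (simp add: sums_iff)
  show "w n = 0" if "n \<ge> 1" using zero[of "n - 1"] that by simp
  show "v = 0" using sums(2) by (simp add: zero sums_iff)
qed

lemma min_at_zero: "min_at 0 0 (\<lambda>n. 0)"
proof (rule min_atI[where z = "\<lambda>n. 0" and c = 0])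
  show "(\<lambda>n. 0) \<in> S \<sigma> 0 0" by (simp add: S_iff)
qed (use S_zero(1) in \<open>auto simp: conj_hE_zero\<close>)

text \<open>Subtracting \<open>t1\<close> times the first constraint from the second leaves a
  vanishing sum of the nonnegative terms \<open>(\<sigma> n - t1) * w n\<close>.\<close>

lemma S_t1_support:
  assumes "w \<in> S \<sigma> u (t1 * u)" "n \<ge> 1" "\<sigma> n \<noteq> t1"
  shows "w n = 0"
proof -
  have sums: "(\<lambda>n. w (Suc n)) sums u" "(\<lambda>n. \<sigma> (Suc n) * w (Suc n)) sums (t1 * u)"
    and nonneg: "\<And>n. 0 \<le> w (Suc n)"
    using assms by (auto simp: S_iff)
  have "(\<lambda>n. \<sigma> (Suc n) * w (Suc n) - t1 * w (Suc n)) sums (t1 * u - t1 * u)"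
    by (intro sums_diff sums_mult sums)
  then have "(\<lambda>n. (\<sigma> (Suc n) - t1) * w (Suc n)) sums 0" by (simp add: left_diff_distrib)
  then have "(\<sigma> (Suc n) - t1) * w (Suc n) = 0" for n
    using suminf_eq_zero_iff[of "\<lambda>n. (\<sigma> (Suc n) - t1) * w (Suc n)"] nonneg t1_le
    by (simp add: sums_iff)
  from this[of "n - 1"] show ?thesis using assms by simp
qed

lemma min_at_t1:
  assumes u: "0 < u"
  shows "min_at u (t1 * u) (\<lambda>n. if n \<ge> 1 \<and> \<sigma> n = t1 then p n * u / P else 0)"
    (is "min_at u ?v ?q")
\<comment> \<open>The density with respect to \<open>p\<close> is constant on the support, so the
  pairing with \<open>z\<close> uses only the first constraint.\<close>
proof (rule min_atI[where z = "\<lambda>n. ln (u / P)" and c = "u * ln (u / P)"])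
  have "(\<lambda>n. if n \<in> M then p (Suc n) * (u / P) else 0) sums (\<Sum>n\<in>M. p (Suc n) * (u / P))"
    using finite_M by (rule sums_If_finite_set)
  also have "(\<Sum>n\<in>M. p (Suc n) * (u / P)) = u"
    using P_pos unfolding sum_distrib_right[symmetric] P_def[symmetric] by simp
  also have "(\<lambda>n. if n \<in> M then p (Suc n) * (u / P) else 0) = (\<lambda>n. ?q (Suc n))"
    by (auto simp: M_def)
  finally have q: "(\<lambda>n. ?q (Suc n)) sums u" .
  have "(\<lambda>n. t1 * ?q (Suc n)) sums (t1 * u)" using q by (rule sums_mult)
  also have "(\<lambda>n. t1 * ?q (Suc n)) = (\<lambda>n. \<sigma> (Suc n) * ?q (Suc n))" by auto
  finally show "?q \<in> S \<sigma> u ?v"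
    using q u P_pos p_pos by (auto simp: S_iff less_imp_le)
  show "?q n = p n * exp (ln (u / P))" if "n \<ge> 1" "?q n \<noteq> 0" for n
    using that u P_pos by (auto split: if_splits)
  show "w n = 0" if "w \<in> S \<sigma> u ?v" "n \<ge> 1" "?q n = 0" for w n
    using that S_t1_support[of w u n] u P_pos p_pos[of n] by (auto split: if_splits)
  show "(\<lambda>n. w (Suc n) * ln (u / P)) sums (u * ln (u / P))" if "w \<in> S \<sigma> u ?v" for w
    using that by (intro sums_mult2) (auto simp: S_iff)
  show "conjugate hE (u, ?v) = ereal (u * ln (u / P) - u)"
    using conj_hE_pos[OF u, of ?v] u P_pos by (simp add: conj_lnfE_t1 ln_div algebra_simps)
qed

lemma exp_mem_S:
  assumes y: "y \<in> D" "y \<in> D1" and u: "0 < u" and v: "v = u * phi y"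
  shows "(\<lambda>n. p n * exp (ln (u / F y) + \<sigma> n * y)) \<in> S \<sigma> u v" (is "?q \<in> _")
proof -
  have eq: "?q n = u / F y * (p n * exp (\<sigma> n * y))" for n
    using u F_pos[OF y(1)] by (simp add: exp_add)
  have "(\<lambda>n. ?q (Suc n)) sums (u / F y * F y)"
    unfolding eq by (intro sums_mult expser_sums y)
  moreover have "(\<lambda>n. u / F y * (p (Suc n) * \<sigma> (Suc n) * exp (\<sigma> (Suc n) * y))) sums (u / F y * F1 y)"
    by (intro sums_mult expser_sums y)
  then have "(\<lambda>n. \<sigma> (Suc n) * ?q (Suc n)) sums (u * phi y)"
    unfolding eq by (simp add: phi_def mult_ac)
  ultimately show ?thesis
    using F_pos[OF y(1)] p_pos by (simp add: S_iff v less_imp_le)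
qed

lemma min_at_exp:
  assumes y: "y \<in> D" "y \<in> D1" and u: "0 < u" and v: "v = u * phi y"
    and conj: "conjugate lnfE (phi y) = ereal (y * phi y - ln (F y))"
  shows "min_at u v (\<lambda>n. p n * exp (ln (u / F y) + \<sigma> n * y))"
proof (rule min_atI[where z = "\<lambda>n. ln (u / F y) + \<sigma> n * y" and c = "ln (u / F y) * u + y * v"])
  show "(\<lambda>n. p n * exp (ln (u / F y) + \<sigma> n * y)) \<in> S \<sigma> u v"
    using assms by (intro exp_mem_S)
  show "w n = 0" if "n \<ge> 1" "p n * exp (ln (u / F y) + \<sigma> n * y) = 0" for w :: "nat \<Rightarrow> real" and n
    using that p_pos[of n] by simp
  show "(\<lambda>n. w (Suc n) * (ln (u / F y) + \<sigma> (Suc n) * y)) sums (ln (u / F y) * u + y * v)"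
    if "w \<in> S \<sigma> u v" for w
  proof -
    have "(\<lambda>n. ln (u / F y) * w (Suc n) + y * (\<sigma> (Suc n) * w (Suc n))) sums (ln (u / F y) * u + y * v)"
      using that by (intro sums_add sums_mult) (auto simp: S_iff)
    then show ?thesis by (simp add: algebra_simps)
  qed
  show "conjugate hE (u, v) = ereal (ln (u / F y) * u + y * v - u)"
    using conj_hE_pos[OF u, of v] u F_pos[OF y(1)] conj by (simp add: v ln_div algebra_simps)
qed simp

lemma t2_mult_iff:
  assumes "0 < u"
  shows "ereal v < t2 * ereal u \<longleftrightarrow> ereal (v / u) < t2"
    and "t2 * ereal u < ereal v \<longleftrightarrow> t2 < ereal (v / u)"
    and "ereal v = t2 * ereal u \<longleftrightarrow> ereal (v / u) = t2"
  using assms by (cases t2; auto simp: field_simps)+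

lemma min_at_phi:
  assumes "0 < u" "y < - alpha" "v = u * phi y"
  shows "min_at u v (\<lambda>n. p n * exp (ln (u / F y) + \<sigma> n * y))"
  using assms in_dom in_dom1 conj_lnfE_phi by (intro min_at_exp) auto

lemma min_at_t2:
  assumes u: "0 < u" and v: "ereal v = t2 * ereal u"
  shows "min_at u v (\<lambda>n. p n * exp (ln (u / F (- alpha)) - \<sigma> n * alpha))"
proof -
  have t2: "t2 = ereal (v / u)" using t2_mult_iff(3)[OF u] v by simp
  then have D: "- alpha \<in> D" "- alpha \<in> D1" using t2_finite_iff by auto
  have eq: "v = u * phi (- alpha)" using t2 at_left_phi[OF D] u by (simp add: field_simps)
  have "conjugate lnfE (phi (- alpha)) = ereal (- alpha * phi (- alpha) - ln (F (- alpha)))"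
    using at_left_phi[OF D] by (intro conj_lnfE_ge_t2) simp
  from min_at_exp[OF D u eq this] show ?thesis by simp
qed

section \<open>Weak duality and the region above \<open>\<theta>2\<close>\<close>

text \<open>The reference attached to \<open>(x, y)\<close> has total mass \<open>h (x, y)\<close>,
  so the constant in \<open>entropy_sum_reference\<close> is the objective of the conjugate at
  \<open>(x, y)\<close>.\<close>

lemma weak_duality: "conjugate hE (u, v) \<le> H p \<sigma> u v"
  unfolding H_eq
proof (rule INF_greatest)
  fix w assume w: "w \<in> S \<sigma> u v"
  have lower: "ereal (x * u + y * v - exp x * F y) \<le> entropy_sum p w" if y: "y \<in> D" for x y
  proof -
    let ?q = "\<lambda>n. p n * exp (x + \<sigma> n * y)"
    have "(\<lambda>n. x * w (Suc n) + y * (\<sigma> (Suc n) * w (Suc n))) sums (x * u + y * v)"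
      using w by (intro sums_add sums_mult) (auto simp: S_iff)
    then have c: "(\<lambda>n. w (Suc n) * (x + \<sigma> (Suc n) * y)) sums (x * u + y * v)"
      by (simp add: algebra_simps)
    have "(\<lambda>n. exp x * (p (Suc n) * exp (\<sigma> (Suc n) * y))) sums (exp x * F y)"
      by (intro sums_mult expser_sums y)
    then have d: "(\<lambda>n. ?q (Suc n)) sums (exp x * F y)" by (simp add: exp_add mult_ac)
    have "\<And>n. n \<ge> 1 \<Longrightarrow> 0 \<le> w n" using w by (simp add: S_iff)
    moreover have "\<And>n. n \<ge> 1 \<Longrightarrow> 0 < ?q n" using p_pos by simp
    ultimately have "entropy_sum p w = ereal (x * u + y * v - exp x * F y) + eseries (\<lambda>n. ereal (gap (w n) (?q n)))"
      "0 \<le> eseries (\<lambda>n. ereal (gap (w n) (?q n)))"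
      by (intro entropy_sum_reference[OF _ _ _ _ c d]; force)+
    then show ?thesis by (cases "eseries (\<lambda>n. ereal (gap (w n) (?q n)))") auto
  qed
  show "conjugate hE (u, v) \<le> entropy_sum p w"
    unfolding conjugate_def
  proof (rule SUP_least)
    fix z :: "real \<times> real"
    show "ereal (z \<bullet> (u, v)) - hE z \<le> entropy_sum p w"
      using lower[of "snd z" "fst z"] by (cases z) (auto simp: hE_simp)
  qed
qed

text \<open>Equality would make the \<open>gap\<close> series against the reference at
  \<open>- alpha\<close> vanish, hence \<open>w\<close> equal to it. That reference has the right
  mass \<open>u\<close> but second sum \<open>\<theta>2 u\<close>, less than
  \<open>v\<close>.\<close>

lemma no_minimum_above_t2:
  assumes u: "0 < u" and v: "t2 * ereal u < ereal v" and w: "w \<in> S \<sigma> u v"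
  shows "entropy_sum p w \<noteq> conjugate hE (u, v)"
proof
  assume eq: "entropy_sum p w = conjugate hE (u, v)"
  have t2: "t2 < ereal (v / u)" using t2_mult_iff(2)[OF u] v by simp
  note conj = conj_lnfE_ge_t2[OF less_imp_le[OF t2]]
  let ?x = "ln (u / F (- alpha))"
  let ?q = "\<lambda>n. p n * exp (?x + \<sigma> n * - alpha)"
  have q: "?q \<in> S \<sigma> u (u * phi (- alpha))"
    using conj u by (intro exp_mem_S) auto
  have "(\<lambda>n. ?x * w (Suc n) + - alpha * (\<sigma> (Suc n) * w (Suc n))) sums (?x * u + - alpha * v)"
    using w by (intro sums_add sums_mult) (auto simp: S_iff)
  then have c: "(\<lambda>n. w (Suc n) * (?x + \<sigma> (Suc n) * - alpha)) sums (?x * u + - alpha * v)"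
    by (simp add: algebra_simps)
  have d: "(\<lambda>n. ?q (Suc n)) sums u" using q by (simp add: S_iff)
  have nonneg: "\<And>n. n \<ge> 1 \<Longrightarrow> 0 \<le> w n" using w by (simp add: S_iff)
  have q0: "\<And>n. n \<ge> 1 \<Longrightarrow> 0 < ?q n" using p_pos by simp
  have ref: "\<And>n. n \<ge> 1 \<Longrightarrow> 0 \<le> ?q n" "\<And>n. n \<ge> 1 \<Longrightarrow> ?q n = 0 \<Longrightarrow> w n = 0"
    using q0 by force+
  note ent = entropy_sum_reference[where q = ?q and z = "\<lambda>n. ?x + \<sigma> n * - alpha", OF nonneg ref(1) refl ref(2) c d]
  have "conjugate hE (u, v) = ereal (?x * u + - alpha * v - u)"
    using conj_hE_pos[OF u, of v] u F_pos[OF conj(2)] conj(1) by (simp add: ln_div algebra_simps)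
  with eq ent(1) have "eseries (\<lambda>n. ereal (gap (w n) (?q n))) = 0"
    by (cases "eseries (\<lambda>n. ereal (gap (w n) (?q n)))") auto
  with ent(3) have "w n = ?q n" if "n \<ge> 1" for n using that by blast
  then have "(\<lambda>n. \<sigma> (Suc n) * w (Suc n)) = (\<lambda>n. \<sigma> (Suc n) * ?q (Suc n))" by auto
  then have "v = u * phi (- alpha)"
    using w q sums_unique2 by (auto simp: S_iff)
  with v at_left_phi conj(2,3) show False by (simp add: mult.commute)
qed

text \<open>Truncating the series to its first \<open>N\<close> terms moves the point at which the quotient of the
  derivative and the function equals \<open>v / u\<close> to some \<open>y\<close> slightly above \<open>- alpha\<close>; as
  \<open>N\<close> grows, the finitely supported sequences obtained this way exhaust the dual value.\<close>

lemma H_eq_above_t2: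
  assumes u: "0 < u" and v: "t2 * ereal u < ereal v"
  shows "conjugate hE (u, v) = H p \<sigma> u v"
proof (rule antisym[OF weak_duality])
  have t2: "t2 < ereal (v / u)" using t2_mult_iff(2)[OF u] v by simp
  note conj = conj_lnfE_ge_t2[OF less_imp_le[OF t2]]
  have phi: "phi (- alpha) < v / u" using t2 at_left_phi conj by simp
  have v0: "0 < v"
  proof -
    have "0 < v / u" using phi t1_less_phi[OF conj(2,3)] t1_pos by linarith
    then show ?thesis using u by (simp add: zero_less_divide_iff)
  qed
  let ?FN = "\<lambda>N y. \<Sum>n<N. p (Suc n) * exp (\<sigma> (Suc n) * y)"
  \<comment> \<open>The truncated minimizer has entropy \<open>x * u + y * v - u\<close>. Bounding
    \<open>y\<close> below inside the sum and above in the linear term removes the unknown root, so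
    that the limits in \<open>N\<close> and then in \<open>e\<close> can be taken.\<close>
  have approx: "\<exists>w\<in>S \<sigma> u v. entropy_sum p w \<le> ereal (u * ln u - u * ln (?FN N (- alpha)) + (- alpha + e) * v - u)"
    if y: "- alpha \<le> y" "y \<le> - alpha + e" and N: "0 < N"
      and root: "(\<Sum>n<N. p (Suc n) * \<sigma> (Suc n) * exp (\<sigma> (Suc n) * y)) = v / u * ?FN N y" for N y e
  proof -
    have FN: "0 < ?FN N z" for z using N p_pos by (intro sum_pos) auto
    define x where "x = ln (u / ?FN N y)"
    define q where "q n = (if n \<le> N then p n * exp (x + \<sigma> n * y) else 0)" for n
    have q_eq: "q (Suc n) = (if n \<in> {..<N} then u / ?FN N y * (p (Suc n) * exp (\<sigma> (Suc n) * y)) else 0)" for n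
      using u FN[of y] by (auto simp: q_def x_def exp_add)
    have "(\<lambda>n. q (Suc n)) sums (\<Sum>n<N. u / ?FN N y * (p (Suc n) * exp (\<sigma> (Suc n) * y)))"
      unfolding q_eq by (rule sums_If_finite_set) simp
    also have "\<dots> = u" using FN[of y] by (simp only: sum_distrib_left[symmetric]) simp
    finally have q1: "(\<lambda>n. q (Suc n)) sums u" .
    have "(\<lambda>n. if n \<in> {..<N} then u / ?FN N y * (p (Suc n) * \<sigma> (Suc n) * exp (\<sigma> (Suc n) * y)) else 0)
      sums (\<Sum>n<N. u / ?FN N y * (p (Suc n) * \<sigma> (Suc n) * exp (\<sigma> (Suc n) * y)))"
      by (rule sums_If_finite_set) simp
    also have "(\<Sum>n<N. u / ?FN N y * (p (Suc n) * \<sigma> (Suc n) * exp (\<sigma> (Suc n) * y))) = v"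
      using FN[of y] u by (simp only: sum_distrib_left[symmetric] root) simp
    also have "(\<lambda>n. if n \<in> {..<N} then u / ?FN N y * (p (Suc n) * \<sigma> (Suc n) * exp (\<sigma> (Suc n) * y)) else 0)
      = (\<lambda>n. \<sigma> (Suc n) * q (Suc n))"
      by (auto simp: q_eq)
    finally have q2: "(\<lambda>n. \<sigma> (Suc n) * q (Suc n)) sums v" .
    have qS: "q \<in> S \<sigma> u v"
      using q1 q2 p_pos by (auto simp: S_iff q_def less_imp_le)
    have "q n * (ln (q n / p n) - 1) = x * q n + y * (\<sigma> n * q n) - q n" if "n \<ge> 1" for n
      using p_pos[OF that] by (auto simp: q_def algebra_simps)
    then have "entropy_sum p q = eseries (\<lambda>n. ereal (x * q n + y * (\<sigma> n * q n) - q n))"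
      unfolding entropy_sum_def by (intro eseries_cong) auto
    also have "\<dots> = ereal (x * u + y * v - u)"
      by (intro eseries_ereal_sums sums_diff sums_add sums_mult q1 q2)
    also have "\<dots> \<le> ereal (u * ln u - u * ln (?FN N (- alpha)) + (- alpha + e) * v - u)"
    proof -
      have "?FN N (- alpha) \<le> ?FN N y"
        by (intro sum_mono term_mono y(1))
      then have "u * ln (?FN N (- alpha)) \<le> u * ln (?FN N y)"
        using u FN[of y] FN[of "- alpha"] by simp
      moreover have "y * v \<le> (- alpha + e) * v" using y(2) v0 by (intro mult_right_mono) auto
      moreover have "x * u = u * ln u - u * ln (?FN N y)"
        using u FN[of y] by (simp add: x_def ln_div algebra_simps)
      ultimately show ?thesis by simp
    qed
    finally show ?thesis using qS by blast
  qed
  have conj_val: "conjugate hE (u, v) = ereal (u * ln u - u * ln (F (- alpha)) - alpha * v - u)"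
    using conj_hE_pos[OF u, of v] u conj(1) by (simp add: algebra_simps)
  have bound: "H p \<sigma> u v \<le> ereal (u * ln u - u * ln (F (- alpha)) + (- alpha + e) * v - u)" if e: "0 < e" for e
  proof (rule tendsto_lowerbound)
    have "(\<lambda>N. ?FN N (- alpha)) \<longlonglongrightarrow> F (- alpha)"
      using expser_sums[OF conj(2)] by (simp add: sums_def)
    then show "(\<lambda>N. ereal (u * ln u - u * ln (?FN N (- alpha)) + (- alpha + e) * v - u))
      \<longlonglongrightarrow> ereal (u * ln u - u * ln (F (- alpha)) + (- alpha + e) * v - u)"
      using F_pos[OF conj(2)] unfolding lim_ereal by (intro tendsto_intros) auto
    show "\<forall>\<^sub>F N in sequentially. H p \<sigma> u v \<le> ereal (u * ln u - u * ln (?FN N (- alpha)) + (- alpha + e) * v - u)"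
      using truncated_root[OF conj(2,3) phi e] eventually_gt_at_top[of 0]
    proof eventually_elim
      case (elim N)
      then obtain w where "w \<in> S \<sigma> u v"
        "entropy_sum p w \<le> ereal (u * ln u - u * ln (?FN N (- alpha)) + (- alpha + e) * v - u)"
        using approx by blast
      then show ?case unfolding H_eq by (intro INF_lower2[of w])
    qed
  qed simp
  \<comment> \<open>The limit in \<open>N\<close> was taken with \<open>e\<close> fixed; now
    \<open>e\<close> tends to 0 from the right.\<close>
  show "H p \<sigma> u v \<le> conjugate hE (u, v)"
  proof (rule tendsto_lowerbound)
    have "((\<lambda>e. u * ln u - u * ln (F (- alpha)) + (- alpha + e) * v - u) \<longlongrightarrow>
      u * ln u - u * ln (F (- alpha)) + (- alpha + 0) * v - u) (at_right 0)"
      by (intro tendsto_intros)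
    then show "((\<lambda>e. ereal (u * ln u - u * ln (F (- alpha)) + (- alpha + e) * v - u)) \<longlongrightarrow> conjugate hE (u, v)) (at_right 0)"
      unfolding conj_val by simp
    show "\<forall>\<^sub>F e in at_right 0. H p \<sigma> u v \<le> ereal (u * ln u - u * ln (F (- alpha)) + (- alpha + e) * v - u)"
      using bound by (simp add: eventually_at_filter)
  qed simp
qed

section \<open>Translation to the constants of the statement\<close>

text \<open>The literal \<open>\<phi>\<close> of the statement. It is compared with
  \<open>phi\<close> only below \<open>- alpha\<close>, where \<open>deriv\<close> is a genuine
  derivative.\<close>

definition phiE :: "real \<Rightarrow> real" where
  "phiE y = deriv (\<lambda>t. real_of_ereal (fE t)) y / real_of_ereal (fE y)"

lemma phiE_eq: "y < - alpha \<Longrightarrow> phiE y = phi y"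
  using DERIV_imp_deriv[OF f_deriv] in_dom by (simp add: phiE_def phi_def fE_def)

lemma Lim_phiE: "Lim (at_left (- alpha)) (\<lambda>y. ereal (phiE y)) = t2"
  and phiE_tendsto: "((\<lambda>y. ereal (phiE y)) \<longlongrightarrow> t2) (at_left (- alpha))"
proof -
  have "\<forall>\<^sub>F y in at_left (- alpha). ereal (phiE y) = ereal (phi y)"
    using phiE_eq by (simp add: eventually_at_filter)
  from phi_tendsto_t2[THEN Lim_transform_eventually, OF eventually_mono[OF this]]
  show *: "((\<lambda>y. ereal (phiE y)) \<longlongrightarrow> t2) (at_left (- alpha))" by simp
  then show "Lim (at_left (- alpha)) (\<lambda>y. ereal (phiE y)) = t2"
    by (intro tendsto_Lim) auto
qed

lemma phiE_bij: "bij_betw phiE {..<- alpha} {w. t1 < w \<and> ereal w < t2}"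
  using phi_bij phiE_eq by (subst bij_betw_cong) auto

lemma phiE_inv: "y < - alpha \<Longrightarrow> the_inv_into {..<- alpha} phiE (phi y) = y"
  using the_inv_into_f_f[OF bij_betw_imp_inj_on[OF phiE_bij], of y] phiE_eq by simp

lemma left_deriv_fE:
  assumes "- alpha \<in> D"
  shows "left_deriv fE (- alpha) = (if - alpha \<in> D1 then ereal (F1 (- alpha)) else \<infinity>)"
  unfolding left_deriv_def
proof (rule tendsto_Lim)
  have "\<forall>\<^sub>F t in at_left (- alpha). ereal ((F t - F (- alpha)) / (t - - alpha))
      = (fE t - fE (- alpha)) / ereal (t - - alpha)"
    using assms in_dom by (simp add: eventually_at_filter fE_def)
  with quotient_tendsto_left[OF assms]
  show "((\<lambda>t. (fE t - fE (- alpha)) / ereal (t - - alpha)) \<longlongrightarrow>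
    (if - alpha \<in> D1 then ereal (F1 (- alpha)) else \<infinity>)) (at_left (- alpha))"
    by (rule Lim_transform_eventually)
qed simp

lemma h_term_GDERIV: "GDERIV (h_term p \<sigma> n) (x, y) :> (p n * exp (x + \<sigma> n * y)) *\<^sub>R (1, \<sigma> n)"
  unfolding gderiv_def h_term_def case_prod_beta
  by (auto intro!: derivative_eq_intros ext simp: inner_prod_def algebra_simps)

lemma gradient_h_term: "gradient (h_term p \<sigma> n) (x, y) = (p n * exp (x + \<sigma> n * y)) *\<^sub>R (1, \<sigma> n)"
  by (rule gradient_eqI) (rule h_term_GDERIV)

lemma gradient_h:
  assumes "y < - alpha"
  shows "gradient (\<lambda>z. real_of_ereal (hE z)) (x, y) = (exp x * F y, exp x * F1 y)"
  by (rule gradient_eqI) (rule h_has_derivative[OF assms])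

lemma gradient_sums:
  assumes "y \<in> D" "y \<in> D1"
  shows "(\<lambda>N. \<Sum>n=1..N. gradient (h_term p \<sigma> n) (x, y)) \<longlonglongrightarrow> exp x *\<^sub>R (F y, F1 y)"
proof -
  have "(\<lambda>n. exp x *\<^sub>R (p (Suc n) * exp (\<sigma> (Suc n) * y), p (Suc n) * \<sigma> (Suc n) * exp (\<sigma> (Suc n) * y)))
      sums (exp x *\<^sub>R (F y, F1 y))"
    using expser_sums[OF assms(1)] expser_sums[OF assms(2)]
    unfolding sums_def by (auto simp: sum_distrib_left[symmetric] sum_prod intro!: tendsto_intros)
  moreover have "exp x *\<^sub>R (p (Suc n) * exp (\<sigma> (Suc n) * y), p (Suc n) * \<sigma> (Suc n) * exp (\<sigma> (Suc n) * y))
      = gradient (h_term p \<sigma> (Suc n)) (x, y)" for n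
    by (simp add: gradient_h_term exp_add)
  ultimately show ?thesis by (simp add: sums_def sum.atLeast1_atMost_eq)
qed

lemma h_term_convex: "\<forall>n\<ge>1. convex_on UNIV (h_term p \<sigma> n)"
  using exp_affine_convex p_pos by (auto simp: h_term_def less_imp_le)

lemma h_differentiable_on: "(\<lambda>z. real_of_ereal (hE z)) differentiable_on UNIV \<times> {..<- alpha}"
proof (rule differentiable_at_imp_differentiable_on)
  fix z assume "z \<in> (UNIV :: real set) \<times> {..<- alpha}"
  then obtain x y where z: "z = (x, y)" "y < - alpha" by auto
  show "(\<lambda>z. real_of_ereal (hE z)) differentiable at z"
    using h_has_derivative[OF z(2), of x] unfolding z(1) gderiv_def by (rule differentiableI)
qed

lemma f_differentiable_on: "(\<lambda>y. real_of_ereal (fE y)) differentiable_on {..<- alpha}"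
  using f_deriv by (intro differentiable_at_imp_differentiable_on) (auto simp: real_differentiable_def)

lemma gradient_image:
  "gradient (\<lambda>z. real_of_ereal (hE z)) ` (UNIV \<times> {..<- alpha}) =
    (\<lambda>(x, y). (exp x * F y, exp x * F1 y)) ` (UNIV \<times> {..<- alpha})"
  using gradient_h by (intro image_cong) auto

lemma subdifferential_image:
  "(\<Union>z\<in>UNIV \<times> {..<- alpha}. subdifferential hE z) =
    gradient (\<lambda>z. real_of_ereal (hE z)) ` (UNIV \<times> {..<- alpha})"
proof -
  have "subdifferential hE z = {gradient (\<lambda>z. real_of_ereal (hE z)) z}" if "z \<in> UNIV \<times> {..<- alpha}" for z
    using that subdifferential_interior gradient_h by (cases z) simp
  then show ?thesis by auto
qed

lemma left_deriv_series:
  "- alpha \<in> D \<longrightarrow> left_deriv fE (- alpha) = eseries (\<lambda>n. ereal (p n * \<sigma> n * exp (- \<sigma> n * alpha)))"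
  using left_deriv_fE eseries_nonneg[of "\<lambda>n. p n * \<sigma> n * exp (- \<sigma> n * alpha)"] p_pos sigma_pos
  by (simp add: expdom_def expser_def less_imp_le)

lemma left_deriv_finite_iff:
  "- alpha \<in> D \<and> left_deriv fE (- alpha) < \<infinity> \<longleftrightarrow> - alpha \<in> D \<and> - alpha \<in> D1"
  using left_deriv_fE by (auto split: if_splits)

lemma boundary_gradient:
  assumes "- alpha \<in> D \<and> left_deriv fE (- alpha) < \<infinity>"
  shows "(\<lambda>N. \<Sum>n=1..N. gradient (h_term p \<sigma> n) (x, - alpha))
      \<longlonglongrightarrow> exp x *\<^sub>R (real_of_ereal (fE (- alpha)), real_of_ereal (left_deriv fE (- alpha)))"
    and "exp x *\<^sub>R (real_of_ereal (fE (- alpha)), real_of_ereal (left_deriv fE (- alpha)))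
      \<in> subdifferential hE (x, - alpha)"
    and "subdifferential hE (x, - alpha) =
      {exp x * real_of_ereal (fE (- alpha))} \<times> {exp x * real_of_ereal (left_deriv fE (- alpha))..}"
proof -
  have D: "- alpha \<in> D" "- alpha \<in> D1" using assms left_deriv_finite_iff by auto
  have eq: "real_of_ereal (fE (- alpha)) = F (- alpha)"
    "real_of_ereal (left_deriv fE (- alpha)) = F1 (- alpha)"
    using D left_deriv_fE by (auto simp: fE_def)
  show "(\<lambda>N. \<Sum>n=1..N. gradient (h_term p \<sigma> n) (x, - alpha))
      \<longlonglongrightarrow> exp x *\<^sub>R (real_of_ereal (fE (- alpha)), real_of_ereal (left_deriv fE (- alpha)))"
    using gradient_sums[OF D] by (simp add: eq)
  show "exp x *\<^sub>R (real_of_ereal (fE (- alpha)), real_of_ereal (left_deriv fE (- alpha)))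
      \<in> subdifferential hE (x, - alpha)"
    using subgradient[OF D, of x] by (simp add: eq)
  show "subdifferential hE (x, - alpha) =
      {exp x * real_of_ereal (fE (- alpha))} \<times> {exp x * real_of_ereal (left_deriv fE (- alpha))..}"
    using subdifferential_boundary[OF D, of x] by (simp add: eq)
qed

lemma phiE_strict_mono: "strict_mono_on {..<- alpha} phiE"
  using phi_strict_mono in_dom in_dom1 by (intro strict_mono_onI) (simp add: phiE_eq)

lemma conj_lnfE_inv:
  assumes "t1 < w" "ereal w < t2"
  shows "conjugate lnfE w =
    ereal (w * the_inv_into {..<- alpha} phiE w) - lnfE (the_inv_into {..<- alpha} phiE w)"
proof -
  obtain y where y: "y < - alpha" "phi y = w" using phi_surj[OF assms] .
  show ?thesis
    using conj_lnfE_phi[OF y(1)] phiE_inv[OF y(1)] y in_dom by (simp add: lnfE_def mult.commute)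
qed

lemma unique_minimum:
  assumes "(u, v) \<in> {(0, 0)} \<union> {(u, v). 0 < u \<and> 0 < v \<and> t1 * u \<le> v \<and> ereal v \<le> t2 * ereal u}"
  shows "\<exists>q. min_at u v q \<and>
    ((u, v) = (0, 0) \<longrightarrow> (\<forall>n\<ge>1. q n = 0)) \<and>
    (0 < u \<and> v = t1 * u \<longrightarrow>
      (\<forall>n\<ge>1. q n = (if n \<in> {n. n \<ge> 1 \<and> \<sigma> n = t1} then p n * u / P else 0))) \<and>
    (0 < u \<and> t1 * u < v \<and> ereal v < t2 * ereal u \<longrightarrow>
      (let y = the_inv_into {..<- alpha} phiE (v / u); x = ln (u / real_of_ereal (fE y))
       in \<forall>n\<ge>1. q n = p n * exp (x + \<sigma> n * y))) \<and>
    (t2 < \<infinity> \<and> 0 < u \<and> ereal v = t2 * ereal u \<longrightarrow>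
      (let x = ln (u / real_of_ereal (fE (- alpha)))
       in \<forall>n\<ge>1. q n = p n * exp (x - \<sigma> n * alpha)))"
proof -
  \<comment> \<open>One \<open>q\<close> has to satisfy all four implications; this makes the one
    for \<open>v = \<theta>2 u\<close> vacuous when \<open>v = \<theta>1 u\<close>.\<close>
  have ne: "ereal (t1 * u) \<noteq> t2 * ereal u" if "0 < u"
    using t2_mult_iff(3)[OF that, of "t1 * u"] t1_less_t2 that by auto
  consider "u = 0" "v = 0" | "0 < u" "v = t1 * u" | "0 < u" "t1 * u < v" "ereal v < t2 * ereal u"
    | "0 < u" "v \<noteq> t1 * u" "ereal v = t2 * ereal u"
    using assms by fastforce
  then show ?thesis
  proof cases
    case 1
    then show ?thesis using min_at_zero by (intro exI[of _ "\<lambda>n. 0"]) simp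
  next
    case 2
    then show ?thesis
      using min_at_t1[OF 2(1)] ne
      by (intro exI[of _ "\<lambda>n. if n \<ge> 1 \<and> \<sigma> n = t1 then p n * u / P else 0"]) auto
  next
    case 3
    then have "t1 < v / u" "ereal (v / u) < t2"
      using t2_mult_iff(1) by (auto simp: pos_less_divide_eq)
    then obtain y where y: "y < - alpha" "phi y = v / u" by (rule phi_surj)
    have "the_inv_into {..<- alpha} phiE (v / u) = y" using phiE_inv[OF y(1)] y(2) by simp
    moreover have "real_of_ereal (fE y) = F y" using in_dom[OF y(1)] by (simp add: fE_def)
    moreover have "min_at u v (\<lambda>n. p n * exp (ln (u / F y) + \<sigma> n * y))"
      using 3(1) y by (intro min_at_phi) auto
    ultimately show ?thesis using 3
      by (intro exI[of _ "\<lambda>n. p n * exp (ln (u / F y) + \<sigma> n * y)"]) (auto simp: Let_def)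
  next
    case 4
    have "ereal (v / u) = t2" using t2_mult_iff(3)[OF 4(1)] 4(3) by simp
    then have "- alpha \<in> D" using t2_finite_iff by auto
    then have "real_of_ereal (fE (- alpha)) = F (- alpha)" by (simp add: fE_def)
    with 4 min_at_t2[OF 4(1,3)] show ?thesis
      by (intro exI[of _ "\<lambda>n. p n * exp (ln (u / F (- alpha)) - \<sigma> n * alpha)"]) (auto simp: Let_def)
  qed
qed

lemma minimum_iff:
  assumes "t1 * u \<le> v" "0 \<le> t1 * u"
  shows "((\<exists>w. is_arg_min (entropy_sum p) (\<lambda>w. w \<in> S \<sigma> u v) w \<and> conjugate hE (u, v) = entropy_sum p w) \<and>
      conjugate hE (u, v) = H p \<sigma> u v) \<longleftrightarrow>
    (u, v) \<in> {(0, 0)} \<union> {(u, v). 0 < u \<and> 0 < v \<and> t1 * u \<le> v \<and> ereal v \<le> t2 * ereal u}"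
    (is "?min \<longleftrightarrow> (u, v) \<in> ?A")
proof
  assume A: "(u, v) \<in> ?A"
  have "\<exists>q. min_at u v q"
    by (rule ex_forward[OF unique_minimum[OF A]]) (erule conjunct1)
  then obtain q where "min_at u v q" ..
  from min_at_imp(1-3)[OF this] show ?min by blast
next
  assume ?min
  then obtain w where w: "w \<in> S \<sigma> u v" "conjugate hE (u, v) = entropy_sum p w"
    by (auto simp: is_arg_min_entropy)
  have "0 \<le> u" using assms(2) t1_pos by (simp add: zero_le_mult_iff)
  then consider "u = 0" | "0 < u" by linarith
  then show "(u, v) \<in> ?A"
  proof cases
    case 1
    then show ?thesis using S_zero(2)[of w v] w(1) by simp
  next
    case 2
    then have "0 < v" using assms(1) t1_pos mult_pos_pos[of t1 u] by linarith
    moreover have "ereal v \<le> t2 * ereal u"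
      using no_minimum_above_t2[OF 2 _ w(1)] w(2) by (metis not_le)
    ultimately show ?thesis using 2 assms by simp
  qed
qed

lemma H_eq_above_t2':
  assumes "0 < t2 * ereal u" "t2 * ereal u < ereal v"
  shows "conjugate hE (u, v) = H p \<sigma> u v"
proof -
  have "0 < t2" using t1_less_t2 t1_pos by (metis ereal_less(2) less_trans)
  then have "0 < u" using assms(1) by (auto simp: ereal_zero_less_0_iff dest: less_asym)
  then show ?thesis using assms(2) by (rule H_eq_above_t2)
qed

end

theorem theorem4p1:
  fixes p \<sigma> :: "nat \<Rightarrow> real"
  assumes p_ge_1: "\<And>n. n \<ge> 1 \<Longrightarrow> p n \<ge> 1"
    and sigma_pos: "\<And>n. n \<ge> 1 \<Longrightarrow> \<sigma> n > 0"
    and sigma_lim: "filterlim \<sigma> at_top sequentially"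
    and dom_h: "edom (h_series p \<sigma>) \<noteq> {}"
  shows
    "let
       hn = h_term p \<sigma>;
       h = h_series p \<sigma>;
       f = f_series p \<sigma>;
       \<phi> = (\<lambda>y. deriv (\<lambda>t. real_of_ereal (f t)) y / real_of_ereal (f y));
       lnf = (\<lambda>y. eln (f y));
       \<theta>1 = (LEAST s. s \<in> \<sigma> ` {1..});
       \<Sigma>' = {n. n \<ge> 1 \<and> \<sigma> n = \<theta>1}
     in
       econvex h \<and> (\<forall>n\<ge>1. convex_on UNIV (hn n)) \<and>
       (\<forall>x y. h (x, y) = ereal (exp x) * f y) \<and>
       edom h = UNIV \<times> edom f \<and>
       (\<exists>\<alpha>\<ge>0.
         let
           I = {..< - \<alpha>};
           \<theta>2 = Lim (at_left (- \<alpha>)) (\<lambda>y. ereal (\<phi> y));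
           \<gamma> = left_deriv f (- \<alpha>);
           \<phi>inv = the_inv_into I \<phi>;
           A = {(0, 0)} \<union> {(u, v). 0 < u \<and> 0 < v \<and> \<theta>1 * u \<le> v \<and> ereal v \<le> \<theta>2 * ereal u}
         in
           I \<subseteq> edom f \<and> edom f \<subseteq> closure I \<and>
           interior (edom h) = UNIV \<times> I \<and>
           UNIV \<times> I \<subseteq> (\<Inter>n\<in>{1..}. edom (\<lambda>z. ereal (hn n z))) \<and>
           (\<Inter>n\<in>{1..}. edom (\<lambda>z. ereal (hn n z))) = UNIV \<and>

           \<comment> \<open>(i)\<close>
           (\<lambda>z. real_of_ereal (h z)) differentiable_on interior (edom h) \<and>
           \<theta>1 \<in> \<sigma> ` {1..} \<and> (\<forall>n\<ge>1. \<theta>1 \<le> \<sigma> n) \<and>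
           (\<lambda>y. real_of_ereal (f y)) differentiable_on I \<and>
           ((\<lambda>y. ereal (\<phi> y)) \<longlongrightarrow> \<theta>2) (at_left (- \<alpha>)) \<and> ereal \<theta>1 < \<theta>2 \<and>
           (\<Union>z\<in>interior (edom h). subdifferential h z)
             = gradient (\<lambda>z. real_of_ereal (h z)) ` (UNIV \<times> I) \<and>
           gradient (\<lambda>z. real_of_ereal (h z)) ` (UNIV \<times> I)
             = {(u, v). 0 < u \<and> \<theta>1 * u < v \<and> ereal v < \<theta>2 * ereal u} \<and>
           (- \<alpha> \<in> edom f \<longrightarrow> \<gamma> = eseries (\<lambda>n. ereal (p n * \<sigma> n * exp (- \<sigma> n * \<alpha>)))) \<and>
           (\<theta>2 < \<infinity> \<longleftrightarrow> - \<alpha> \<in> edom f \<and> \<gamma> < \<infinity>) \<and>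
           (- \<alpha> \<in> edom f \<and> \<gamma> < \<infinity> \<longrightarrow>
             (\<forall>x.
               (\<lambda>N. \<Sum>n=1..N. gradient (hn n) (x, - \<alpha>))
                 \<longlonglongrightarrow> exp x *\<^sub>R (real_of_ereal (f (- \<alpha>)), real_of_ereal \<gamma>) \<and>
               exp x *\<^sub>R (real_of_ereal (f (- \<alpha>)), real_of_ereal \<gamma>)
                 \<in> subdifferential h (x, - \<alpha>) \<and>
               subdifferential h (x, - \<alpha>)
                 = {exp x * real_of_ereal (f (- \<alpha>))} \<times> {exp x * real_of_ereal \<gamma> ..})) \<and>

           \<comment> \<open>(ii)\<close>
           bij_betw \<phi> I {w. \<theta>1 < w \<and> ereal w < \<theta>2} \<and>
           strict_mono_on I \<phi> \<and>
           econvex lnf \<and>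
           strictly_econvex_on (edom lnf) lnf \<and>
           strict_mono_on (edom lnf) lnf \<and>
           (\<forall>w.
             (w < \<theta>1 \<longrightarrow> conjugate lnf w = \<infinity>) \<and>
             (w = \<theta>1 \<longrightarrow> conjugate lnf w = ereal (- ln (\<Sum>n\<in>\<Sigma>'. p n))) \<and>
             (\<theta>1 < w \<and> ereal w < \<theta>2 \<longrightarrow>
                conjugate lnf w = ereal (w * \<phi>inv w) - eln (f (\<phi>inv w))) \<and>
             (\<theta>2 \<le> ereal w \<longrightarrow> conjugate lnf w = ereal (- \<alpha> * w) - eln (f (- \<alpha>)))) \<and>
           edom (conjugate h) = {(u, v). v \<ge> \<theta>1 * u \<and> \<theta>1 * u \<ge> 0} \<and>
           (\<forall>u v.
             (v \<ge> \<theta>1 * u \<and> \<theta>1 * u > 0 \<longrightarrow>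
                conjugate h (u, v) = ereal (u * ln u - u) + ereal u * conjugate lnf (v / u)) \<and>
             (u = 0 \<and> 0 \<le> v \<longrightarrow> conjugate h (u, v) = ereal (- \<alpha> * v))) \<and>

           \<comment> \<open>(iii)\<close>
           (\<forall>(u, v)\<in>edom (conjugate h).
             ((\<exists>w. is_arg_min (entropy_sum p) (\<lambda>w. w \<in> S \<sigma> u v) w \<and>
                   conjugate h (u, v) = entropy_sum p w) \<and>
               conjugate h (u, v) = H p \<sigma> u v)
             \<longleftrightarrow> (u, v) \<in> A) \<and>
           (\<forall>(u, v)\<in>A. \<exists>ubar.
             is_arg_min (entropy_sum p) (\<lambda>w. w \<in> S \<sigma> u v) ubar \<and>
             (\<forall>w. is_arg_min (entropy_sum p) (\<lambda>w. w \<in> S \<sigma> u v) w \<longrightarrow>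
                (\<forall>n\<ge>1. w n = ubar n)) \<and>
             ((u, v) = (0, 0) \<longrightarrow> (\<forall>n\<ge>1. ubar n = 0)) \<and>
             (0 < u \<and> v = \<theta>1 * u \<longrightarrow>
                (\<forall>n\<ge>1. ubar n = (if n \<in> \<Sigma>' then p n * u / (\<Sum>k\<in>\<Sigma>'. p k) else 0))) \<and>
             (0 < u \<and> \<theta>1 * u < v \<and> ereal v < \<theta>2 * ereal u \<longrightarrow>
                (let y = \<phi>inv (v / u); x = ln (u / real_of_ereal (f y))
                 in \<forall>n\<ge>1. ubar n = p n * exp (x + \<sigma> n * y))) \<and>
             (\<theta>2 < \<infinity> \<and> 0 < u \<and> ereal v = \<theta>2 * ereal u \<longrightarrow>
                (let x = ln (u / real_of_ereal (f (- \<alpha>)))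
                 in \<forall>n\<ge>1. ubar n = p n * exp (x - \<sigma> n * \<alpha>)))) \<and>
           (\<forall>v>0. S \<sigma> 0 v = {}) \<and>
           (\<forall>u v. 0 < \<theta>2 * ereal u \<and> \<theta>2 * ereal u < ereal v \<longrightarrow>
              conjugate h (u, v) = H p \<sigma> u v))"
proof -
  interpret mb_setup p \<sigma>
    by unfold_locales (fact p_ge_1 sigma_pos sigma_lim dom_h)+
  show ?thesis
    unfolding Let_def f_series_eq h_series_eq t1_eq eln_fE phiE_def[symmetric]
      edom_fE edom_hE edom_lnfE edom_conj_hE interior_dom sum_Suc_M
  \<comment> \<open>\<open>\<theta>2\<close> is stated as a limit at \<open>- \<alpha>\<close>, so
    it can be rewritten to \<open>t2\<close> only after the witness \<open>alpha\<close> is in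
    place.\<close>
  proof (intro conjI exI[of _ alpha]; (unfold Lim_phiE)?)
    show "\<forall>n\<ge>1. convex_on UNIV (h_term p \<sigma> n)" by (rule h_term_convex)
    show "\<forall>x y. hE (x, y) = ereal (exp x) * fE y" by (simp add: hE_def)
    show "0 \<le> alpha" by (rule alpha_nonneg)
    show "{..<- alpha} \<subseteq> D" using in_dom by auto
    show "D \<subseteq> closure {..<- alpha}" using dom_le by auto
    show "t1 \<in> \<sigma> ` {1..}" unfolding image_from_1 by (rule t1_in)
    show "\<forall>n\<ge>1. t1 \<le> \<sigma> n" using t1_le[of "_ - 1"] by (metis Suc_diff_1 Suc_le_eq One_nat_def)
    show "- alpha \<in> D \<longrightarrow> left_deriv fE (- alpha) = eseries (\<lambda>n. ereal (p n * \<sigma> n * exp (- \<sigma> n * alpha)))"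
      by (rule left_deriv_series)
    show "(t2 < \<infinity>) = (- alpha \<in> D \<and> left_deriv fE (- alpha) < \<infinity>)"
      unfolding left_deriv_finite_iff by (rule t2_finite_iff)
    show "- alpha \<in> D \<and> left_deriv fE (- alpha) < \<infinity> \<longrightarrow>
      (\<forall>x. (\<lambda>N. \<Sum>n=1..N. gradient (h_term p \<sigma> n) (x, - alpha))
          \<longlonglongrightarrow> exp x *\<^sub>R (real_of_ereal (fE (- alpha)), real_of_ereal (left_deriv fE (- alpha))) \<and>
        exp x *\<^sub>R (real_of_ereal (fE (- alpha)), real_of_ereal (left_deriv fE (- alpha)))
          \<in> subdifferential hE (x, - alpha) \<and>
        subdifferential hE (x, - alpha) =
          {exp x * real_of_ereal (fE (- alpha))} \<times> {exp x * real_of_ereal (left_deriv fE (- alpha))..})"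
      using boundary_gradient by blast
    show "gradient (\<lambda>z. real_of_ereal (hE z)) ` (UNIV \<times> {..<- alpha}) =
      {(u, v). 0 < u \<and> t1 * u < v \<and> ereal v < t2 * ereal u}"
      unfolding gradient_image by (rule gradient_range)
    show "\<forall>w. (w < t1 \<longrightarrow> conjugate lnfE w = \<infinity>) \<and>
      (w = t1 \<longrightarrow> conjugate lnfE w = ereal (- ln P)) \<and>
      (t1 < w \<and> ereal w < t2 \<longrightarrow> conjugate lnfE w =
        ereal (w * the_inv_into {..<- alpha} phiE w) - lnfE (the_inv_into {..<- alpha} phiE w)) \<and>
      (t2 \<le> ereal w \<longrightarrow> conjugate lnfE w = ereal (- alpha * w) - lnfE (- alpha))"
      using conj_lnfE_less_t1 conj_lnfE_t1 conj_lnfE_inv conj_lnfE_ge_t2 by (simp add: lnfE_def)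
    show "\<forall>u v. (t1 * u \<le> v \<and> 0 < t1 * u \<longrightarrow>
        conjugate hE (u, v) = ereal (u * ln u - u) + ereal u * conjugate lnfE (v / u)) \<and>
      (u = 0 \<and> 0 \<le> v \<longrightarrow> conjugate hE (u, v) = ereal (- alpha * v))"
      using conj_hE_pos conj_hE_zero t1_pos by (simp add: zero_less_mult_iff)
    show "\<forall>(u, v)\<in>{(u, v). t1 * u \<le> v \<and> 0 \<le> t1 * u}.
      ((\<exists>w. is_arg_min (entropy_sum p) (\<lambda>w. w \<in> S \<sigma> u v) w \<and> conjugate hE (u, v) = entropy_sum p w) \<and>
        conjugate hE (u, v) = H p \<sigma> u v) \<longleftrightarrow>
      (u, v) \<in> {(0, 0)} \<union> {(u, v). 0 < u \<and> 0 < v \<and> t1 * u \<le> v \<and> ereal v \<le> t2 * ereal u}"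
      using minimum_iff by blast
    show "\<forall>(u, v)\<in>{(0, 0)} \<union> {(u, v). 0 < u \<and> 0 < v \<and> t1 * u \<le> v \<and> ereal v \<le> t2 * ereal u}.
      \<exists>ubar. is_arg_min (entropy_sum p) (\<lambda>w. w \<in> S \<sigma> u v) ubar \<and>
        (\<forall>w. is_arg_min (entropy_sum p) (\<lambda>w. w \<in> S \<sigma> u v) w \<longrightarrow> (\<forall>n\<ge>1. w n = ubar n)) \<and>
        ((u, v) = (0, 0) \<longrightarrow> (\<forall>n\<ge>1. ubar n = 0)) \<and>
        (0 < u \<and> v = t1 * u \<longrightarrow>
          (\<forall>n\<ge>1. ubar n = (if n \<in> {n. n \<ge> 1 \<and> \<sigma> n = t1} then p n * u / P else 0))) \<and>
        (0 < u \<and> t1 * u < v \<and> ereal v < t2 * ereal u \<longrightarrow>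
          (\<forall>n\<ge>1. ubar n = p n * exp (ln (u / real_of_ereal (fE (the_inv_into {..<- alpha} phiE (v / u))))
            + \<sigma> n * the_inv_into {..<- alpha} phiE (v / u)))) \<and>
        (t2 < \<infinity> \<and> 0 < u \<and> ereal v = t2 * ereal u \<longrightarrow>
          (\<forall>n\<ge>1. ubar n = p n * exp (ln (u / real_of_ereal (fE (- alpha))) - \<sigma> n * alpha)))"
    proof (clarify, goal_cases)
      case (1 u v)
      then obtain q where q: "min_at u v q" and rest: "((u, v) = (0, 0) \<longrightarrow> (\<forall>n\<ge>1. q n = 0)) \<and>
        (0 < u \<and> v = t1 * u \<longrightarrow>
          (\<forall>n\<ge>1. q n = (if n \<in> {n. n \<ge> 1 \<and> \<sigma> n = t1} then p n * u / P else 0))) \<and>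
        (0 < u \<and> t1 * u < v \<and> ereal v < t2 * ereal u \<longrightarrow>
          (\<forall>n\<ge>1. q n = p n * exp (ln (u / real_of_ereal (fE (the_inv_into {..<- alpha} phiE (v / u))))
            + \<sigma> n * the_inv_into {..<- alpha} phiE (v / u)))) \<and>
        (t2 < \<infinity> \<and> 0 < u \<and> ereal v = t2 * ereal u \<longrightarrow>
          (\<forall>n\<ge>1. q n = p n * exp (ln (u / real_of_ereal (fE (- alpha))) - \<sigma> n * alpha)))"
        using unique_minimum[of u v] unfolding Let_def by blast
      have "is_arg_min (entropy_sum p) (\<lambda>w. w \<in> S \<sigma> u v) q \<and>
        (\<forall>w. is_arg_min (entropy_sum p) (\<lambda>w. w \<in> S \<sigma> u v) w \<longrightarrow> (\<forall>n\<ge>1. w n = q n))"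
        using min_at_imp[OF q] by blast
      with rest show ?case by (intro exI[of _ q]) blast
    qed
    show "\<forall>v>0. S \<sigma> 0 v = {}" using S_zero(2) by (metis all_not_in_conv less_irrefl)
    show "\<forall>u v. 0 < t2 * ereal u \<and> t2 * ereal u < ereal v \<longrightarrow> conjugate hE (u, v) = H p \<sigma> u v"
      using H_eq_above_t2' by blast
  qed (rule refl hE_convex h_differentiable_on f_differentiable_on phiE_tendsto t1_less_t2
      subdifferential_image phiE_bij phiE_strict_mono lnfE_convex lnfE_strictly_convex lnfE_strict_mono
    | simp add: edom_def)+
qed

end
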